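(* Let $n,m$ be relatively prime natural numbers with $m<2n<\sqrt{2}\,m$. Then for every $p\in(0,1)$ there exists $a=a_{n,m}>p^p(1-p)^{1-p}$ with $\Lambda_p(a)=2\pi n/m$, and the corresponding $p$-elastic curve $\gamma_{n,m}:=\gamma_a$ in $\mathbb{S}^2$ is a closed curve with non-constant curvature; it closes up after $m$ periods of its curvature, with total angular progression $2\pi n$ around the pole.
   Context: $\mathbb{S}^2$ is the unit sphere in $\mathbb{R}^3$; geodesic curvature $\kappa$ of an arc-length parametrized curve is defined by $\nabla_T T=\kappa N$ with $T=\gamma'$ and $N$ the rotation of $T$ by $+\pi/2$ in the tangent plane. For $p\in(0,1)$, $\mathbf{\Theta}_p(\gamma)=\int_\gamma\kappa^p\,ds$ acts on convex curves ($\kappa>0$), and a $p$-elastic curve is a convex curve with $p\,(\kappa^{p-1})''+(p-1)\kappa^{p+1}+p\,\kappa^{p-1}=0$. For $a>a_*:=p^p(1-p)^{1-p}$, $\gamma_a$ denotes the (unique up to isometries of $\mathbb{S}^2$ and shifts of $s$) $p$-elastic curve, defined on $\mathbb{R}$, whose non-constant periodic curvature satisfies $p^2(p-1)^2\kappa^{2(p-2)}(\kappa')^2+(p-1)^2\kappa^{2p}+p^2\kappa^{2(p-1)}=a$. With $Q_{p,a}(\kappa)=a\kappa^{2(1-p)}-(1-p)^2\kappa^2-p^2$ and $\beta<\alpha$ its two positive zeros, $\Lambda_p(a)=2p(1-p)^2\sqrt{a}\int_\beta^\alpha \kappa^{1-p}\big((a\kappa^{2(1-p)}-p^2)\sqrt{Q_{p,a}(\kappa)}\big)^{-1}d\kappa$,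 which equals the angular progression $(1-p)\sqrt a\int_0^\varrho \kappa^{2-p}/(a\kappa^{2(1-p)}-p^2)\,ds$ of $\gamma_a$ over one period $\varrho$ of its curvature. *)

theory Defs
  imports "HOL-Analysis.Analysis" "HOL-Analysis.Cross3"
begin

definition a_star :: "real \<Rightarrow> real" where
  "a_star p = p powr p * (1 - p) powr (1 - p)"

definition Qpa :: "real \<Rightarrow> real \<Rightarrow> real \<Rightarrow> real" where
  "Qpa p a k = a * k powr (2 * (1 - p)) - (1 - p)^2 * k^2 - p^2"

definition beta_zero :: "real \<Rightarrow> real \<Rightarrow> real" where
  "beta_zero p a = Min {k. 0 < k \<and> Qpa p a k = 0}"

definition alpha_zero :: "real \<Rightarrow> real \<Rightarrow> real" where
  "alpha_zero p a = Max {k. 0 < k \<and> Qpa p a k = 0}"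

definition Lambda :: "real \<Rightarrow> real \<Rightarrow> real" where
  "Lambda p a = 2 * p * (1 - p)^2 * sqrt a *
     integral {beta_zero p a..alpha_zero p a}
       (\<lambda>k. k powr (1 - p) /
            ((a * k powr (2 * (1 - p)) - p^2) * sqrt (Qpa p a k)))"

definition sphere_arclength_curve ::
  "(real \<Rightarrow> real^3) \<Rightarrow> (real \<Rightarrow> real^3) \<Rightarrow> (real \<Rightarrow> real^3) \<Rightarrow> bool" where
  "sphere_arclength_curve \<gamma> T T2 \<longleftrightarrow>
     (\<forall>s. norm (\<gamma> s) = 1 \<and> norm (T s) = 1 \<and>
          (\<gamma> has_vector_derivative T s) (at s) \<and>
          (T has_vector_derivative T2 s) (at s)) \<and>
     continuous_on UNIV T2"

text \<open>Geodesic curvature: nabla_T T = kappa N with N = gamma x T (rotation of T by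
  +pi/2 in the tangent plane oriented by the outward normal gamma); since the
  tangential part of gamma'' is gamma'' + gamma and N is orthogonal to gamma,
  kappa = <gamma'', gamma x gamma'>.\<close>
definition geod_curv :: "(real \<Rightarrow> real^3) \<Rightarrow> (real \<Rightarrow> real^3) \<Rightarrow> (real \<Rightarrow> real^3) \<Rightarrow> real \<Rightarrow> real" where
  "geod_curv \<gamma> T T2 s = T2 s \<bullet> cross3 (\<gamma> s) (T s)"

definition p_elastic :: "real \<Rightarrow> (real \<Rightarrow> real^3) \<Rightarrow> (real \<Rightarrow> real^3) \<Rightarrow> (real \<Rightarrow> real^3) \<Rightarrow> bool" where
  "p_elastic p \<gamma> T T2 \<longleftrightarrow>
     sphere_arclength_curve \<gamma> T T2 \<and>
     (\<forall>s. geod_curv \<gamma> T T2 s > 0) \<and>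
     (\<exists>u1 u2. \<forall>s.
        ((\<lambda>t. geod_curv \<gamma> T T2 t powr (p - 1)) has_real_derivative u1 s) (at s) \<and>
        (u1 has_real_derivative u2 s) (at s) \<and>
        p * u2 s + (p - 1) * geod_curv \<gamma> T T2 s powr (p + 1)
          + p * geod_curv \<gamma> T T2 s powr (p - 1) = 0)"

text \<open>The curve gamma_a: a p-elastic curve defined on all of R whose curvature is
  non-constant, periodic, and satisfies the first integral with constant a.\<close>
definition is_gamma_a :: "real \<Rightarrow> real \<Rightarrow> (real \<Rightarrow> real^3) \<Rightarrow> (real \<Rightarrow> real^3) \<Rightarrow> (real \<Rightarrow> real^3) \<Rightarrow> bool" where
  "is_gamma_a p a \<gamma> T T2 \<longleftrightarrow>
     p_elastic p \<gamma> T T2 \<and>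
     (\<exists>s1 s2. geod_curv \<gamma> T T2 s1 \<noteq> geod_curv \<gamma> T T2 s2) \<and>
     (\<exists>r>0. \<forall>s. geod_curv \<gamma> T T2 (s + r) = geod_curv \<gamma> T T2 s) \<and>
     (\<forall>s. geod_curv \<gamma> T T2 differentiable at s \<and>
        p^2 * (p - 1)^2 * geod_curv \<gamma> T T2 s powr (2 * (p - 2)) * (deriv (geod_curv \<gamma> T T2) s)^2
        + (p - 1)^2 * geod_curv \<gamma> T T2 s powr (2 * p)
        + p^2 * geod_curv \<gamma> T T2 s powr (2 * (p - 1)) = a)"

definition is_min_period :: "(real \<Rightarrow> real) \<Rightarrow> real \<Rightarrow> bool" where
  "is_min_period f \<rho> \<longleftrightarrow> 0 < \<rho> \<and> (\<forall>s. f (s + \<rho>) = f s) \<and>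
     (\<forall>r. 0 < r \<and> r < \<rho> \<longrightarrow> \<not> (\<forall>s. f (s + r) = f s))"

end

theory Submission
  imports Defs "HOL-Real_Asymp.Real_Asymp"
begin

text \<open>
  Put \<open>u = \<kappa> powr (p - 1)\<close>, \<open>q = p / (1 - p)\<close> and \<open>E = a / p\<^sup>2\<close>. The equation of a \<open>p\<close>-elastic curve
  becomes \<open>u'' = - V' u / 2\<close> for the strictly convex potential
  \<open>V u = u\<^sup>2 + u powr (- 2 * q) / q\<^sup>2\<close>, and its first integral is \<open>u'\<^sup>2 + V u = E\<close>. Let \<open>u0\<close> be the
  minimum point of \<open>V\<close>, let \<open>w\<close> be the signed square root of \<open>V - V u0\<close>, a diffeomorphism
  from the positive half-line onto the real line with inverse \<open>h\<close>, and let \<open>R\<^sup>2 = E - V u0\<close>. Then all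
  solutions are \<open>u = h (R * sin \<phi>)\<close>, \<open>u' = R * cos \<phi>\<close> with \<open>\<phi>' = w' u\<close>; so period and angular progression
  are integrals over \<open>{0..2 * pi}\<close> of functions depending continuously on \<open>R\<close>, also at \<open>R = 0\<close>.

  At \<open>R = 0\<close> the angular progression is \<open>sqrt 2 * pi\<close>. For large \<open>E\<close> it is
  below any bound greater than \<open>pi\<close>: near the upper turning point the angle is compared with \<open>arcsin t\<close>, \<open>t = u powr (- q) / (q * sqrt (E - u\<^sup>2))\<close>
  (\<open>t\<close> is the sine of the angle between the curve and the meridian), and the remaining part is
  negligible because \<open>E - V\<close> is concave. The intermediate value theorem gives the required \<open>R\<close>.

  The vector \<open>u \<gamma> + u' T + \<kappa> powr p / q N\<close> is constant along the curve and has length \<open>sqrt E\<close>.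
  In spherical coordinates about it, the height of \<open>\<gamma>\<close> is \<open>u / sqrt E\<close> and the polar angle
  advances by the angular progression in each period, which decides when the curve closes.
\<close>

section \<open>Oscillation in a convex potential well\<close>

text \<open>The motion in question is \<open>u'' = - V1 u / 2\<close> with conserved quantity
  \<open>u'^2 + V u\<close>. Blow-up of \<open>V\<close> at both ends of the half-line gives every
  energy level above the minimum two turning points.\<close>

locale convex_well =
  fixes V V1 V2 :: "real \<Rightarrow> real" and u0 :: real
  assumes V_deriv: "0 < u \<Longrightarrow> (V has_real_derivative V1 u) (at u)"
    and V1_deriv: "0 < u \<Longrightarrow> (V1 has_real_derivative V2 u) (at u)"
    and V2_pos: "0 < u \<Longrightarrow> 0 < V2 u"
    and u0_pos: "0 < u0" and V1_u0: "V1 u0 = 0"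
    and V_at_0: "filterlim V at_top (at_right 0)"
    and V_at_top: "filterlim V at_top at_top"
begin

lemma V1_strict_mono:
  assumes "0 < u" "u < v" shows "V1 u < V1 v"
proof (rule DERIV_pos_imp_increasing[OF assms(2)])
  fix x assume "u \<le> x" "x \<le> v"
  then show "\<exists>y. (V1 has_real_derivative y) (at x) \<and> 0 < y"
    using V1_deriv[of x] V2_pos[of x] assms by (intro exI[of _ "V2 x"]) auto
qed

lemma V1_pos: "u0 < u \<Longrightarrow> 0 < V1 u"
  using V1_strict_mono[of u0 u] u0_pos V1_u0 by simp

lemma V1_neg: "0 < u \<Longrightarrow> u < u0 \<Longrightarrow> V1 u < 0"
  using V1_strict_mono[of u u0] V1_u0 by simp

lemma V_cont: "0 < u \<Longrightarrow> isCont V u"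
  using V_deriv DERIV_isCont by blast

lemma V_gt_min: assumes "0 < u" "u \<noteq> u0" shows "V u0 < V u"
proof (cases "u0 < u")
  case True
  then show ?thesis
  proof (rule DERIV_pos_imp_increasing_open)
    show "continuous_on {u0..u} V"
      using u0_pos by (intro continuous_at_imp_continuous_on ballI V_cont) auto
    fix x assume "u0 < x" "x < u"
    then show "\<exists>y. (V has_real_derivative y) (at x) \<and> 0 < y"
      using V_deriv[of x] V1_pos[of x] u0_pos by (intro exI[of _ "V1 x"]) auto
  qed
next
  case False
  with assms have "u < u0" by simp
  then show ?thesis
  proof (rule DERIV_neg_imp_decreasing_open)
    show "continuous_on {u..u0} V"
      using assms by (intro continuous_at_imp_continuous_on ballI V_cont) auto
    fix x assume "u < x" "x < u0"
    then show "\<exists>y. (V has_real_derivative y) (at x) \<and> y < 0"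
      using V_deriv[of x] V1_neg[of x] assms by (intro exI[of _ "V1 x"]) auto
  qed
qed

text \<open>Morse coordinate at the minimum: in the plane with coordinates \<open>w u\<close> and
  \<open>u'\<close> an energy level is a full circle, so the root singularities of the usual period
  integral at the turning points disappear.\<close>

definition w :: "real \<Rightarrow> real" where
  "w u = sgn (u - u0) * sqrt (V u - V u0)"

text \<open>The derivative of \<open>w\<close>: away from \<open>u0\<close> it comes from
  differentiating \<open>w^2 = V - V u0\<close>, and at \<open>u0\<close> it is the limit of that
  quotient.\<close>

definition dw :: "real \<Rightarrow> real" where
  "dw u = (if u = u0 then sqrt (V2 u0 / 2) else V1 u / (2 * w u))"

lemma w_u0 [simp]: "w u0 = 0" by (simp add: w_def)

lemma w_pos: "u0 < u \<Longrightarrow> 0 < w u"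
  using V_gt_min[of u] u0_pos by (simp add: w_def)

lemma w_neg: "0 < u \<Longrightarrow> u < u0 \<Longrightarrow> w u < 0"
  using V_gt_min[of u] by (simp add: w_def)

lemma w_sq: "0 < u \<Longrightarrow> (w u)\<^sup>2 = V u - V u0"
  using V_gt_min[of u] by (cases "u = u0") (auto simp: w_def power_mult_distrib sgn_if)

lemma V_conv_w: "0 < u \<Longrightarrow> V u = V u0 + (w u)\<^sup>2"
  using w_sq by simp

lemma dw_pos: "0 < u \<Longrightarrow> 0 < dw u"
  using V2_pos[of u0] w_pos[of u] w_neg[of u] V1_pos[of u] V1_neg[of u] u0_pos
  by (cases u u0 rule: linorder_cases) (auto simp: dw_def zero_less_divide_iff)

lemma V1_eq: "0 < u \<Longrightarrow> V1 u = 2 * w u * dw u"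
  using w_pos[of u] w_neg[of u] V1_u0
  by (cases u u0 rule: linorder_cases) (auto simp: dw_def)

lemma V1_quot: "((\<lambda>u. V1 u / (u - u0)) \<longlongrightarrow> V2 u0) (at u0)"
  using V1_deriv[OF u0_pos] V1_u0 by (simp add: has_field_derivative_iff)

lemma ev_pos: "\<forall>\<^sub>F u in at u0. 0 < u \<and> u \<noteq> u0"
  using eventually_at_in_open[of "{0<..}" u0] u0_pos by (auto elim: eventually_mono)

text \<open>The second-order Taylor coefficient: one application of l'Hopital leaves half the
  difference quotient of \<open>V1\<close> at its zero.\<close>

lemma V_quot: "((\<lambda>u. (V u - V u0) / (u - u0)\<^sup>2) \<longlongrightarrow> V2 u0 / 2) (at u0)"
proof (rule lhopital)
  have "isCont V u0" using V_deriv[OF u0_pos] DERIV_isCont by blast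
  then show "((\<lambda>u. V u - V u0) \<longlongrightarrow> 0) (at u0)"
    by (simp add: isCont_def LIM_zero_iff)
  show "((\<lambda>u. (u - u0)\<^sup>2) \<longlongrightarrow> 0) (at u0)"
    by (auto intro!: tendsto_eq_intros)
  show "\<forall>\<^sub>F u in at u0. (u - u0)\<^sup>2 \<noteq> 0" "\<forall>\<^sub>F u in at u0. 2 * (u - u0) \<noteq> 0"
    using ev_pos by (auto elim: eventually_mono)
  show "\<forall>\<^sub>F u in at u0. ((\<lambda>u. V u - V u0) has_real_derivative V1 u) (at u)"
    using ev_pos by eventually_elim (auto intro!: derivative_eq_intros V_deriv)
  show "\<forall>\<^sub>F u in at u0. ((\<lambda>u. (u - u0)\<^sup>2) has_real_derivative 2 * (u - u0)) (at u)"
    by (auto intro!: always_eventually derivative_eq_intros)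
  show "((\<lambda>u. V1 u / (2 * (u - u0))) \<longlongrightarrow> V2 u0 / 2) (at u0)"
    using tendsto_mult_right[OF V1_quot, of "1/2"] by (simp add: field_simps)
qed

lemma w_quot: "((\<lambda>u. w u / (u - u0)) \<longlongrightarrow> sqrt (V2 u0 / 2)) (at u0)"
proof -
  have "((\<lambda>u. sqrt ((V u - V u0) / (u - u0)\<^sup>2)) \<longlongrightarrow> sqrt (V2 u0 / 2)) (at u0)"
    by (intro tendsto_real_sqrt V_quot)
  \<comment> \<open>The sign in \<open>w\<close> matches that of \<open>u - u0\<close>, so the
    quotient is nonnegative and equals the root of its square.\<close>
  moreover have "\<forall>\<^sub>F u in at u0. sqrt ((V u - V u0) / (u - u0)\<^sup>2) = w u / (u - u0)"
    using ev_pos by eventually_elim (auto simp: w_def real_sqrt_divide sgn_if minus_divide_right)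
  ultimately show ?thesis using tendsto_cong by fast
qed

lemma w_deriv: assumes "0 < u" shows "(w has_real_derivative dw u) (at u)"
proof (cases "u = u0")
  case True
  then show ?thesis using w_quot by (simp add: has_field_derivative_iff dw_def)
next
  case False
  \<comment> \<open>Away from \<open>u0\<close> the factor \<open>sgn (u - u0)\<close> is locally
    constant, so the root can be differentiated with the factor frozen at \<open>c\<close>.\<close>
  define c where "c = sgn (u - u0)"
  have c: "c = 1 \<or> c = -1" using False by (auto simp: c_def sgn_if)
  have "((\<lambda>u. c * sqrt (V u - V u0)) has_real_derivative dw u) (at u)"
    using V_gt_min[OF assms False] False c
    by (auto intro!: derivative_eq_intros V_deriv assms simp: dw_def w_def c_def[symmetric] divide_simps)
  moreover have "\<forall>\<^sub>F v in nhds u. sgn (v - u0) = c"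
  proof (cases "u0 < u")
    case True
    then have "\<forall>\<^sub>F v in nhds u. v \<in> {u0<..}" by (intro eventually_nhds_in_open) auto
    then show ?thesis by eventually_elim (use True in \<open>auto simp: c_def\<close>)
  next
    case F: False
    then have "\<forall>\<^sub>F v in nhds u. v \<in> {..<u0}" using False by (intro eventually_nhds_in_open) auto
    then show ?thesis by eventually_elim (use F False in \<open>auto simp: c_def\<close>)
  qed
  then have "\<forall>\<^sub>F v in nhds u. w v = c * sqrt (V v - V u0)"
    by eventually_elim (simp add: w_def)
  ultimately show ?thesis using DERIV_cong_ev by fast
qed

lemma w_cont: "0 < u \<Longrightarrow> isCont w u"
  using w_deriv DERIV_isCont by blast

text \<open>At \<open>u0\<close> numerator and denominator of \<open>V1 u / (2 * w u)\<close> both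
  vanish to first order; dividing each by \<open>u - u0\<close> leaves two known limits.\<close>

lemma dw_cont: assumes "0 < u" shows "isCont dw u"
proof (cases "u = u0")
  case True
  have "((\<lambda>u. (V1 u / (u - u0)) / (2 * (w u / (u - u0)))) \<longlongrightarrow> V2 u0 / (2 * sqrt (V2 u0 / 2))) (at u0)"
    using V2_pos[OF u0_pos] by (intro tendsto_intros V1_quot w_quot) simp
  moreover have "V2 u0 / (2 * sqrt (V2 u0 / 2)) = sqrt (V2 u0 / 2)"
    using real_div_sqrt[of "V2 u0 / 2"] V2_pos[OF u0_pos] by simp
  moreover have "\<forall>\<^sub>F u in at u0. (V1 u / (u - u0)) / (2 * (w u / (u - u0))) = dw u"
    using ev_pos by eventually_elim (auto simp: dw_def)
  ultimately have "(dw \<longlongrightarrow> sqrt (V2 u0 / 2)) (at u0)" using tendsto_cong by force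
  then show ?thesis using True by (simp add: isCont_def dw_def)
next
  case False
  have "isCont V1 u" using V1_deriv[OF assms] DERIV_isCont by blast
  moreover have "w u \<noteq> 0" using w_pos[of u] w_neg[of u] False assms by force
  ultimately have "isCont (\<lambda>u. V1 u / (2 * w u)) u"
    using w_cont[OF assms] by (intro continuous_intros) auto
  moreover have "\<forall>\<^sub>F v in nhds u. v \<in> -{u0}"
    using False by (intro eventually_nhds_in_open) auto
  then have "\<forall>\<^sub>F v in nhds u. V1 v / (2 * w v) = dw v"
    by eventually_elim (auto simp: dw_def)
  ultimately show ?thesis using isCont_cong by fast
qed

lemma w_strict_mono:
  assumes "0 < u" "u < v" shows "w u < w v"
proof (rule DERIV_pos_imp_increasing[OF assms(2)])
  fix x assume "u \<le> x" "x \<le> v"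
  then show "\<exists>y. (w has_real_derivative y) (at x) \<and> 0 < y"
    using w_deriv[of x] dw_pos[of x] assms by (intro exI[of _ "dw x"]) auto
qed

lemma w_inj: "0 < u \<Longrightarrow> 0 < v \<Longrightarrow> w u = w v \<Longrightarrow> u = v"
  using w_strict_mono by (metis linorder_neqE_linordered_idom less_irrefl)

lemma w_surj: "\<exists>u>0. w u = y"
proof -
  \<comment> \<open>Above this level of \<open>V\<close> the modulus of \<open>w\<close> is at least
    that of \<open>y\<close>. Blow-up at both ends supplies points \<open>lo\<close> and
    \<open>hi\<close> on the two sides of \<open>u0\<close> for the intermediate value
    theorem.\<close>
  define K where "K = V u0 + y\<^sup>2 + 1"
  have big: "\<bar>y\<bar> \<le> sqrt (V u - V u0)" if "K \<le> V u" for u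
    using that real_sqrt_le_mono[of "y\<^sup>2" "V u - V u0"] by (simp add: K_def)
  have "\<forall>\<^sub>F u in at_right 0. K \<le> V u" using V_at_0 by (simp add: filterlim_at_top)
  then obtain b where b: "0 < b" "\<And>u. 0 < u \<Longrightarrow> u < b \<Longrightarrow> K \<le> V u"
    by (auto simp: eventually_at_right_field)
  define lo where "lo = min b u0 / 2"
  have lo: "0 < lo" "lo < b" "lo < u0" using b(1) u0_pos by (auto simp: lo_def min_def)
  have "\<forall>\<^sub>F u in at_top. K \<le> V u" using V_at_top by (simp add: filterlim_at_top)
  then obtain B where B: "\<And>u. B \<le> u \<Longrightarrow> K \<le> V u"
    by (auto simp: eventually_at_top_linorder)
  define hi where "hi = max B (u0 + 1)"
  have hi: "B \<le> hi" "u0 < hi" by (auto simp: hi_def)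
  have "w lo \<le> y" using big[OF b(2)[of lo]] lo by (simp add: w_def)
  moreover have "y \<le> w hi" using big[OF B[of hi]] hi by (simp add: w_def)
  ultimately obtain u where "lo \<le> u" "w u = y"
    using IVT[of w lo y hi] lo hi w_cont by force
  then show ?thesis using lo(1) by (intro exI[of _ u]) simp
qed

definition h :: "real \<Rightarrow> real" where
  "h y = (THE u. 0 < u \<and> w u = y)"

lemma h_pos: "0 < h y" and w_h [simp]: "w (h y) = y"
proof -
  have "\<exists>!u. 0 < u \<and> w u = y" using w_surj w_inj by blast
  then have "0 < h y \<and> w (h y) = y" unfolding h_def by (rule theI')
  then show "0 < h y" "w (h y) = y" by auto
qed

lemma h_w: "0 < u \<Longrightarrow> h (w u) = u"
  using w_inj h_pos w_h by blast

lemma h_strict_mono: "y < y' \<Longrightarrow> h y < h y'"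
  using w_strict_mono[of "h y'" "h y"] h_pos w_h
  by (metis less_asym less_irrefl linorder_neqE_linordered_idom)

text \<open>The phase runs at speed \<open>dw u\<close>, so \<open>g\<close> is time per unit of
  phase; it is also the derivative of \<open>h\<close>.\<close>

definition g :: "real \<Rightarrow> real" where
  "g y = inverse (dw (h y))"

lemma g_pos: "0 < g y"
  by (simp add: g_def dw_pos h_pos)

lemma h_cont: "isCont h y"
proof -
  have "isCont h (w (h y))"
  proof (rule isCont_inverse_function[where f = w and g = h and x = "h y" and d = "h y / 2"])
    show "0 < h y / 2" using h_pos by simp
    have *: "0 < z" if "\<bar>z - h y\<bar> \<le> h y / 2" for z using that h_pos[of y] by arith
    show "\<And>z. \<bar>z - h y\<bar> \<le> h y / 2 \<Longrightarrow> h (w z) = z" using * h_w by blast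
    show "\<And>z. \<bar>z - h y\<bar> \<le> h y / 2 \<Longrightarrow> isCont w z" using * w_cont by blast
  qed
  then show ?thesis by simp
qed

lemma h_deriv: "(h has_real_derivative g y) (at y)"
  unfolding g_def
proof (rule DERIV_inverse_function[where f = w and a = "y - 1" and b = "y + 1"])
  show "(w has_real_derivative dw (h y)) (at (h y))" by (intro w_deriv h_pos)
  show "dw (h y) \<noteq> 0" using dw_pos[OF h_pos[of y]] by simp
qed (auto simp: h_cont)

lemma g_cont: "isCont g y"
  unfolding g_def
  using dw_pos[OF h_pos[of y]]
  by (intro continuous_intros isCont_o2[OF h_cont] dw_cont h_pos) auto

lemma V_h: "V (h y) = V u0 + y\<^sup>2"
  using V_conv_w[OF h_pos] by simp

text \<open>The two points are the turning points of the motion of amplitude \<open>R\<close>; they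
  coincide for \<open>R = 0\<close>.\<close>

lemma level_set:
  assumes "0 \<le> R"
  shows "{u. 0 < u \<and> V u = V u0 + R\<^sup>2} = {h R, h (- R)}"
proof -
  have "u \<in> {h R, h (- R)}" if "0 < u" "V u = V u0 + R\<^sup>2" for u
  proof -
    have "(w u)\<^sup>2 = R\<^sup>2" using w_sq[OF that(1)] that(2) by simp
    then have "w u = R \<or> w u = - R" by (simp add: power2_eq_iff)
    then show ?thesis using h_w[OF that(1)] by auto
  qed
  then show ?thesis using V_h h_pos by auto
qed

end

section \<open>Antiderivatives on the whole line and periodic integrands\<close>

lemma antiderivative_exists:
  fixes f :: "real \<Rightarrow> real"
  assumes "\<And>x. isCont f x"
  shows "\<exists>F. \<forall>x. (F has_real_derivative f x) (at x)"
  using einterval_antiderivative[of "-\<infinity>" "\<infinity>" f] assms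
  by (auto simp: has_real_derivative_iff_has_vector_derivative)

lemma has_real_derivative_eq_imp_diff_eq:
  fixes F G :: "real \<Rightarrow> real"
  assumes "\<And>x. (F has_real_derivative f x) (at x)" "\<And>x. (G has_real_derivative f x) (at x)"
  shows "F x - F y = G x - G y"
proof -
  have "((\<lambda>x. F x - G x) has_real_derivative 0) (at x)" for x
    using DERIV_diff[OF assms(1)[of x] assms(2)[of x]] by simp
  then have "F x - G x = F y - G y" by (intro DERIV_isconst_all) auto
  then show ?thesis by simp
qed

lemma integral_eq_antiderivative_diff:
  fixes F :: "real \<Rightarrow> real"
  assumes "\<And>x. (F has_real_derivative f x) (at x)" "a \<le> b"
  shows "integral {a..b} f = F b - F a"
  using assms
  by (intro integral_unique fundamental_theorem_of_calculus)
     (auto simp: has_real_derivative_iff_has_vector_derivative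
       intro: has_vector_derivative_at_within)

lemma antiderivative_periodic_shift:
  fixes F :: "real \<Rightarrow> real"
  assumes F: "\<And>x. (F has_real_derivative f x) (at x)" and f: "\<And>x. f (x + t) = f x" and "0 \<le> t"
  shows "F (x + t) = F x + integral {0..t} f"
proof -
  have "((\<lambda>x. F (x + t)) has_real_derivative f x) (at x)" for x
    using F[of "x + t"] f[of x] by (simp add: DERIV_shift)
  from has_real_derivative_eq_imp_diff_eq[OF this F, of x 0]
  show ?thesis using integral_eq_antiderivative_diff[OF F, of 0 t] assms(3) by simp
qed

section \<open>Phase, period and advance of an oscillation\<close>

context convex_well
begin

text \<open>Motion along the circle of radius \<open>R\<close>, as an autonomous equation for the
  angle. Its right-hand side is positive everywhere, so turning points are passed like any other
  point.\<close>

definition is_phase :: "real \<Rightarrow> (real \<Rightarrow> real) \<Rightarrow> bool" where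
  "is_phase R \<phi> \<longleftrightarrow> (\<forall>s. (\<phi> has_real_derivative dw (h (R * sin (\<phi> s)))) (at s))"

definition period :: "real \<Rightarrow> real" where
  "period R = integral {0..2 * pi} (\<lambda>\<psi>. g (R * sin \<psi>))"

text \<open>Growth over one period of time of any antiderivative of \<open>\<Theta> (u s)\<close>,
  after substituting the phase for the time. The fixed interval of integration lets \<open>R\<close>
  go down to 0.\<close>

definition advance :: "(real \<Rightarrow> real) \<Rightarrow> real \<Rightarrow> real" where
  "advance \<Theta> R = integral {0..2 * pi} (\<lambda>\<psi>. \<Theta> (h (R * sin \<psi>)) * g (R * sin \<psi>))"

lemma g_sin_cont: "isCont (\<lambda>\<psi>. g (R * sin \<psi>)) x"
  by (intro isCont_o2[OF _ g_cont]) (intro continuous_intros)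

lemma h_sin_cont: "isCont (\<lambda>\<psi>. h (R * sin \<psi>)) x"
  by (intro isCont_o2[OF _ h_cont]) (intro continuous_intros)

lemma g_dw: "g y * dw (h y) = 1"
  using dw_pos[OF h_pos[of y]] by (simp add: g_def)

text \<open>Separation of variables: \<open>G\<close> is time as a function of phase, and inverting
  it produces a phase.\<close>

lemma time_of_phase_exists:
  obtains G where "\<And>x. (G has_real_derivative g (R * sin x)) (at x)" "strict_mono G"
    "\<And>x. G (x + 2 * pi) = G x + period R"
proof -
  obtain G where G: "\<And>x. (G has_real_derivative g (R * sin x)) (at x)"
    using antiderivative_exists[OF g_sin_cont] by blast
  have "G x < G y" if "x < y" for x y
    by (rule DERIV_pos_imp_increasing[OF that]) (use G g_pos in blast)
  then have "strict_mono G" by (rule strict_monoI)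
  moreover have "G (x + 2 * pi) = G x + period R" for x
    unfolding period_def by (rule antiderivative_periodic_shift[OF G]) auto
  ultimately show ?thesis using G by (intro that)
qed

lemma period_pos: "0 < period R"
proof -
  obtain G where G: "\<And>x. (G has_real_derivative g (R * sin x)) (at x)" "strict_mono G"
    "\<And>x. G (x + 2 * pi) = G x + period R"
    by (rule time_of_phase_exists[of R], rule that)
  have "G 0 < G (0 + 2 * pi)" by (rule strict_monoD[OF G(2)]) simp
  then show ?thesis using G(3)[of 0] by linarith
qed

text \<open>Composed with \<open>\<phi>\<close>, the time function \<open>G\<close> has slope 1, so
  one period of time raises it by exactly the amount of a full turn; injectivity of \<open>G\<close>
  does the rest.\<close>

lemma is_phase_shift:
  assumes "is_phase R \<phi>"
  shows "\<phi> (s + period R) = \<phi> s + 2 * pi"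
proof -
  obtain G where G: "\<And>x. (G has_real_derivative g (R * sin x)) (at x)" "strict_mono G"
    "\<And>x. G (x + 2 * pi) = G x + period R"
    by (rule time_of_phase_exists[of R], rule that)
  have "((\<lambda>s. G (\<phi> s)) has_real_derivative 1) (at s)" for s
    using DERIV_chain2[OF G(1) assms[unfolded is_phase_def, rule_format]] g_dw by simp
  from has_real_derivative_eq_imp_diff_eq[OF this DERIV_ident, of "s + period R" s]
  have "G (\<phi> (s + period R)) = G (\<phi> s + 2 * pi)" using G(3) by simp
  then show ?thesis using strict_mono_eq[OF G(2)] by simp
qed

lemma is_phase_strict_mono:
  assumes "is_phase R \<phi>" shows "strict_mono \<phi>"
proof (rule strict_monoI)
  fix x y :: real assume "x < y"
  then show "\<phi> x < \<phi> y"
    by (rule DERIV_pos_imp_increasing) (use assms dw_pos h_pos is_phase_def in blast)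
qed

lemma is_phase_exists: "\<exists>\<phi>. is_phase R \<phi>"
proof -
  obtain G where G: "\<And>x. (G has_real_derivative g (R * sin x)) (at x)" "strict_mono G"
    "\<And>x. G (x + 2 * pi) = G x + period R"
    by (rule time_of_phase_exists[of R], rule that)
  have up: "G (x + 2 * pi * real k) = G x + period R * real k" for x k
  proof (induction k)
    case (Suc k)
    have "G (x + 2 * pi * real (Suc k)) = G ((x + 2 * pi * real k) + 2 * pi)"
      by (simp add: algebra_simps)
    also have "\<dots> = G x + period R * real k + period R" using G(3) Suc by simp
    finally show ?case by (simp add: algebra_simps)
  qed simp
  have cont: "isCont G x" for x using G(1) DERIV_isCont by blast
  have "\<exists>x. G x = y" for y
  proof -
    \<comment> \<open>Surjectivity of \<open>G\<close>: whole turns change it by multiples of the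
      positive period, so every \<open>y\<close> is enclosed between two of its values.\<close>
    obtain k :: nat where k: "\<bar>y - G 0\<bar> < real k * period R"
      using reals_Archimedean3[OF period_pos] by blast
    have "G (- (2 * pi * real k)) \<le> y" "y \<le> G (2 * pi * real k)"
      using up[of "- (2 * pi * real k)" k] up[of 0 k] k by (auto simp: mult.commute)
    then show ?thesis
      using IVT[of G "- (2 * pi * real k)" y "2 * pi * real k"] cont by auto
  qed
  then obtain \<phi> where \<phi>: "\<And>y. G (\<phi> y) = y" by metis
  have \<phi>_G: "\<phi> (G x) = x" for x using \<phi> strict_mono_eq[OF G(2)] by blast
  have "isCont \<phi> y" for y
    using isCont_inverse_function[where d = 1 and x = "\<phi> y" and g = \<phi> and f = G] \<phi> \<phi>_G cont by simp
  then have "(\<phi> has_real_derivative inverse (g (R * sin (\<phi> y)))) (at y)" for y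
    using DERIV_inverse_function[where f = G and g = \<phi> and x = y and D = "g (R * sin (\<phi> y))"
        and a = "y - 1" and b = "y + 1"]
      G(1) g_pos[of "R * sin (\<phi> y)"] \<phi> by simp
  then show ?thesis by (auto simp: is_phase_def g_def)
qed

lemma phase_solves:
  assumes "is_phase R \<phi>"
  shows "((\<lambda>s. h (R * sin (\<phi> s))) has_real_derivative R * cos (\<phi> s)) (at s)"
    and "((\<lambda>s. R * cos (\<phi> s)) has_real_derivative - V1 (h (R * sin (\<phi> s))) / 2) (at s)"
proof -
  note \<phi> = assms[unfolded is_phase_def, rule_format]
  have "((\<lambda>s. h (R * sin (\<phi> s))) has_real_derivative
      g (R * sin (\<phi> s)) * (R * (dw (h (R * sin (\<phi> s))) * cos (\<phi> s)))) (at s)"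
    by (rule DERIV_chain2[OF h_deriv]) (auto intro!: derivative_eq_intros \<phi>)
  then show "((\<lambda>s. h (R * sin (\<phi> s))) has_real_derivative R * cos (\<phi> s)) (at s)"
    using g_dw[of "R * sin (\<phi> s)"] by (metis (no_types, lifting) mult.assoc mult.commute mult.right_neutral)
  show "((\<lambda>s. R * cos (\<phi> s)) has_real_derivative - V1 (h (R * sin (\<phi> s))) / 2) (at s)"
    by (auto intro!: derivative_eq_intros \<phi> simp: V1_eq h_pos)
qed

text \<open>The final theorem speaks of every curve with the given data, so an arbitrary solution
  has to be brought into the explicit form. The candidate phase integrates \<open>dw (u s)\<close>
  and starts at the polar angle \<open>t\<close> of the initial point on the circle.\<close>

lemma energy_solution_has_phase:
  assumes "0 < R" and u: "\<And>s. 0 < u s"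
    and u_deriv: "\<And>s. (u has_real_derivative v s) (at s)"
    and v_deriv: "\<And>s. (v has_real_derivative - V1 (u s) / 2) (at s)"
    and energy: "\<And>s. (v s)\<^sup>2 + V (u s) = V u0 + R\<^sup>2"
  obtains \<phi> where "is_phase R \<phi>" "\<And>s. u s = h (R * sin (\<phi> s))" "\<And>s. v s = R * cos (\<phi> s)"
proof -
  have "isCont (\<lambda>s. dw (u s)) s" for s
    using u_deriv DERIV_isCont by (intro isCont_o2[OF _ dw_cont] u) blast
  then obtain \<phi>0 where \<phi>0: "\<And>s. (\<phi>0 has_real_derivative dw (u s)) (at s)"
    using antiderivative_exists by blast
  have "(v 0 / R)\<^sup>2 + (w (u 0) / R)\<^sup>2 = 1"
    using energy[of 0] w_sq[OF u[of 0]] \<open>0 < R\<close> by (simp add: power_divide add_divide_distrib[symmetric])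
  then obtain t where t: "v 0 / R = cos t" "w (u 0) / R = sin t"
    using sincos_total_2pi by metis
  define \<phi> where "\<phi> s = \<phi>0 s - \<phi>0 0 + t" for s
  have \<phi>: "(\<phi> has_real_derivative dw (u s)) (at s)" for s
    unfolding \<phi>_def by (auto intro!: derivative_eq_intros \<phi>0)
  \<comment> \<open>\<open>(v, w u) / R\<close> and \<open>(cos \<phi>, sin \<phi>)\<close> rotate with the same angular speed, so their distance is constant.\<close>
  define d where "d s = (v s - R * cos (\<phi> s))\<^sup>2 + (w (u s) - R * sin (\<phi> s))\<^sup>2" for s
  have wu: "((\<lambda>s. w (u s)) has_real_derivative dw (u s) * v s) (at s)" for s
    by (rule DERIV_chain2[OF w_deriv u_deriv]) (rule u)
  have "(d has_real_derivative 0) (at s)" for s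
    unfolding d_def
    by (auto intro!: derivative_eq_intros u_deriv v_deriv wu \<phi> simp: V1_eq[OF u])
       (simp add: algebra_simps)
  then have "d s = d 0" for s by (intro DERIV_isconst_all) auto
  moreover have "d 0 = 0" using t \<open>0 < R\<close> by (simp add: d_def \<phi>_def field_simps)
  ultimately have *: "v s = R * cos (\<phi> s)" "w (u s) = R * sin (\<phi> s)" for s
    by (auto simp: d_def sum_power2_eq_zero_iff)
  have **: "u s = h (R * sin (\<phi> s))" for s using *(2) h_w[OF u] by metis
  then have "is_phase R \<phi>" using \<phi> by (simp add: is_phase_def)
  with * ** show ?thesis using that by blast
qed

text \<open>Equal sine and cosine mean that the phase has moved by whole turns; as it increases, it
  has made at least one, and one turn takes \<open>period R\<close>.\<close>

lemma period_minimal: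
  assumes \<phi>: "is_phase R \<phi>" and "0 < r"
    and "sin (\<phi> r) = sin (\<phi> 0)" "cos (\<phi> r) = cos (\<phi> 0)"
  shows "period R \<le> r"
proof -
  obtain k :: int where k: "\<phi> r = \<phi> 0 + 2 * pi * k"
    using assms(3,4) sin_cos_eq_iff by metis
  have "\<phi> 0 < \<phi> r" using is_phase_strict_mono[OF \<phi>] \<open>0 < r\<close> by (simp add: strict_monoD)
  then have "0 < k" using k by (simp add: zero_less_mult_iff)
  then have "2 * pi * 1 \<le> 2 * pi * real_of_int k" by (intro mult_left_mono) auto
  then have "\<phi> (0 + period R) \<le> \<phi> r" using is_phase_shift[OF \<phi>, of 0] k by simp
  then show ?thesis using strict_mono_less_eq[OF is_phase_strict_mono[OF \<phi>]] by simp
qed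

lemma advance_shift:
  assumes \<phi>: "is_phase R \<phi>" and \<Theta>: "\<And>u. u \<in> range (\<lambda>\<psi>. h (R * sin \<psi>)) \<Longrightarrow> isCont \<Theta> u"
    and \<theta>: "\<And>s. (\<theta> has_real_derivative \<Theta> (h (R * sin (\<phi> s)))) (at s)"
  shows "\<theta> (s + period R) = \<theta> s + advance \<Theta> R"
proof -
  have "isCont (\<lambda>\<psi>. \<Theta> (h (R * sin \<psi>)) * g (R * sin \<psi>)) x" for x
    by (intro continuous_intros isCont_o2[OF h_sin_cont \<Theta>] g_sin_cont) auto
  then obtain \<Psi> where \<Psi>: "\<And>x. (\<Psi> has_real_derivative \<Theta> (h (R * sin x)) * g (R * sin x)) (at x)"
    using antiderivative_exists by blast
  have "((\<lambda>s. \<Psi> (\<phi> s)) has_real_derivative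
      \<Theta> (h (R * sin (\<phi> s))) * g (R * sin (\<phi> s)) * dw (h (R * sin (\<phi> s)))) (at s)" for s
    by (rule DERIV_chain2[OF \<Psi>]) (rule \<phi>[unfolded is_phase_def, rule_format])
  then have "((\<lambda>s. \<Psi> (\<phi> s)) has_real_derivative \<Theta> (h (R * sin (\<phi> s)))) (at s)" for s
    by (simp add: mult.assoc g_dw)
  from has_real_derivative_eq_imp_diff_eq[OF \<theta> this, of "s + period R" s]
  have "\<theta> (s + period R) - \<theta> s = \<Psi> (\<phi> s + 2 * pi) - \<Psi> (\<phi> s)"
    by (simp add: is_phase_shift[OF \<phi>])
  also have "\<dots> = advance \<Theta> R"
    using antiderivative_periodic_shift[OF \<Psi>, of "2 * pi" "\<phi> s"] by (simp add: advance_def)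
  finally show ?thesis by simp
qed

text \<open>Returns from the phase to the variable \<open>u\<close>, where the integrand is singular
  at the turning points. The antiderivative \<open>P\<close>, continuous up to the endpoints, stands
  for the improper integral and suits comparison by monotonicity.\<close>

lemma advance_half:
  assumes "0 < R" and \<Theta>: "\<And>u. u \<in> range (\<lambda>\<psi>. h (R * sin \<psi>)) \<Longrightarrow> isCont \<Theta> u"
  obtains P where "continuous_on {h (- R)..h R} P"
    "\<And>u. u \<in> {h (- R)<..<h R} \<Longrightarrow> (P has_real_derivative \<Theta> u / sqrt (R\<^sup>2 - (w u)\<^sup>2)) (at u)"
    "advance \<Theta> R = 2 * (P (h R) - P (h (- R)))"
proof -
  define f where "f \<psi> = \<Theta> (h (R * sin \<psi>)) * g (R * sin \<psi>)" for \<psi>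
  have "isCont f x" for x
    unfolding f_def by (intro continuous_intros isCont_o2[OF h_sin_cont \<Theta>] g_sin_cont) auto
  then obtain \<Psi> where \<Psi>: "\<And>x. (\<Psi> has_real_derivative f x) (at x)"
    using antiderivative_exists by blast
  have per: "\<Psi> (x + 2 * pi) = \<Psi> x + advance \<Theta> R" for x
    using antiderivative_periodic_shift[OF \<Psi>, of "2 * pi" x] by (simp add: advance_def f_def)
  \<comment> \<open>The integrand is symmetric under \<open>\<psi> \<mapsto> pi - \<psi>\<close>, so half of a turn gives half of the advance.\<close>
  have "((\<lambda>x. \<Psi> x + \<Psi> (pi - x)) has_real_derivative 0) (at x)" for x
  proof -
    have "((\<lambda>x. \<Psi> x + \<Psi> (pi - x)) has_real_derivative f x + f (pi - x) * (0 - 1)) (at x)"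
      by (intro DERIV_add \<Psi> DERIV_chain2[OF \<Psi>] DERIV_diff DERIV_const DERIV_ident)
    then show ?thesis by (simp add: f_def)
  qed
  then have "\<Psi> (pi/2) + \<Psi> (pi - pi/2) = \<Psi> (- (pi/2)) + \<Psi> (pi - - (pi/2))"
    by (intro DERIV_isconst_all[where f = "\<lambda>x. \<Psi> x + \<Psi> (pi - x)"]) auto
  moreover have "\<Psi> (pi - - (pi/2)) = \<Psi> (- (pi/2)) + advance \<Theta> R"
    using per[of "- (pi/2)"] by (simp add: field_simps)
  ultimately have adv: "advance \<Theta> R = 2 * (\<Psi> (pi/2) - \<Psi> (- (pi/2)))" by simp
  \<comment> \<open>On the half-turn from -pi/2 to pi/2 the phase belonging to \<open>u\<close> is
    \<open>arcsin (w u / R)\<close>. This is continuous on the closed interval, and differentiated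
    only inside it.\<close>
  define P where "P u = \<Psi> (arcsin (w u / R))" for u
  have cont_\<Psi>: "continuous_on UNIV \<Psi>"
    using \<Psi> DERIV_isCont by (intro continuous_at_imp_continuous_on) blast
  show ?thesis
  proof (rule that[of P])
    have w_le: "- R \<le> w u \<and> w u \<le> R" and pos: "0 < u" if "u \<in> {h (- R)..h R}" for u
    proof -
      show "0 < u" using that h_pos[of "- R"] by simp
      then show "- R \<le> w u \<and> w u \<le> R"
        using that w_strict_mono[of "h (- R)" u] w_strict_mono[of u "h R"] h_pos[of "- R"] \<open>0 < R\<close>
        by (cases "u = h (- R)"; cases "u = h R") auto
    qed
    have "continuous_on {h (- R)..h R} (\<lambda>u. w u / R)"
      using pos \<open>0 < R\<close>
      by (intro continuous_on_divide continuous_on_const continuous_at_imp_continuous_on ballI w_cont) auto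
    then have "continuous_on {h (- R)..h R} (\<lambda>u. arcsin (w u / R))"
      by (rule continuous_on_arcsin) (use w_le \<open>0 < R\<close> in \<open>auto simp: divide_simps\<close>)
    then show "continuous_on {h (- R)..h R} P"
      unfolding P_def by (rule continuous_on_compose2[OF cont_\<Psi>]) auto
    fix u assume u: "u \<in> {h (- R)<..<h R}"
    then have u0: "0 < u" using pos by simp
    have wb: "- R < w u" "w u < R"
      using u w_strict_mono[of "h (- R)" u] w_strict_mono[of u "h R"] h_pos[of "- R"] u0 by auto
    then have "-1 < w u / R" "w u / R < 1" using \<open>0 < R\<close> by (auto simp: field_simps)
    then have a: "(P has_real_derivative
        f (arcsin (w u / R)) * (inverse (sqrt (1 - (w u / R)\<^sup>2)) * (dw u / R))) (at u)"
      unfolding P_def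
      by (intro DERIV_chain2[OF \<Psi>] DERIV_chain2[OF DERIV_arcsin] DERIV_cdivide w_deriv u0)
    have "R * sin (arcsin (w u / R)) = w u"
      using \<open>-1 < w u / R\<close> \<open>w u / R < 1\<close> \<open>0 < R\<close> by simp
    then have f: "f (arcsin (w u / R)) = \<Theta> u * g (w u)" by (simp add: f_def h_w u0)
    have "R * sqrt (1 - (w u / R)\<^sup>2) = sqrt (R\<^sup>2 - (w u)\<^sup>2)"
    proof -
      have "R\<^sup>2 - (w u)\<^sup>2 = R\<^sup>2 * (1 - (w u / R)\<^sup>2)" using \<open>0 < R\<close> by (simp add: field_simps)
      then show ?thesis using \<open>0 < R\<close> by (simp only: real_sqrt_mult) simp
    qed
    moreover have "g (w u) * dw u = 1" using g_dw[of "w u"] h_w[OF u0] by simp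
    ultimately show "(P has_real_derivative \<Theta> u / sqrt (R\<^sup>2 - (w u)\<^sup>2)) (at u)"
      using a \<open>0 < R\<close> unfolding f
      by (simp add: field_simps)
  next
    show "advance \<Theta> R = 2 * (P (h R) - P (h (- R)))"
      using adv \<open>0 < R\<close> by (simp add: P_def)
  qed
qed

end

section \<open>The potential of an elastic curve\<close>

definition pot :: "real \<Rightarrow> real \<Rightarrow> real" where
  "pot q u = u\<^sup>2 + u powr (- 2 * q) / q\<^sup>2"

definition pot1 :: "real \<Rightarrow> real \<Rightarrow> real" where
  "pot1 q u = 2 * u - 2 / q * u powr (- 2 * q - 1)"

definition pot2 :: "real \<Rightarrow> real \<Rightarrow> real" where
  "pot2 q u = 2 + 2 * (2 * q + 1) / q * u powr (- 2 * q - 2)"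

text \<open>The solution of \<open>u powr (2 * q + 2) = 1 / q\<close>, which is
  \<open>pot1 q u = 0\<close> rewritten.\<close>

definition argmin_pot :: "real \<Rightarrow> real" where
  "argmin_pot q = q powr (- 1 / (2 * q + 2))"

text \<open>Angular speed about the axis: the height of the curve is \<open>u / sqrt E\<close>, the
  normal component of the axis is \<open>u powr (- q) / (q * sqrt E)\<close>, and the speed is the
  latter divided by one minus the squared height.\<close>

definition rate :: "real \<Rightarrow> real \<Rightarrow> real \<Rightarrow> real" where
  "rate q E u = sqrt E * u powr (- q) / (q * (E - u\<^sup>2))"

locale power_well =
  fixes q :: real
  assumes q_pos: "0 < q"

sublocale power_well \<subseteq> convex_well "pot q" "pot1 q" "pot2 q" "argmin_pot q"
proof
  note q = q_pos
  show "(pot q has_real_derivative pot1 q u) (at u)" if "0 < u" for u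
  proof -
    have "(pot q has_real_derivative
        real 2 * u ^ (2 - Suc 0) + (- 2 * q) * u powr (- 2 * q - 1) / q\<^sup>2) (at u)"
      unfolding pot_def[abs_def]
      by (intro DERIV_add DERIV_pow DERIV_cdivide has_real_derivative_powr that)
    then show ?thesis using q by (simp add: pot1_def power2_eq_square)
  qed
  show "(pot1 q has_real_derivative pot2 q u) (at u)" if "0 < u" for u
  proof -
    have "(pot1 q has_real_derivative
        2 * 1 - 2 / q * ((- 2 * q - 1) * u powr (- 2 * q - 1 - 1))) (at u)"
      unfolding pot1_def[abs_def]
      by (intro DERIV_diff DERIV_cmult DERIV_ident has_real_derivative_powr that)
    moreover have "- 2 * q - 1 - 1 = - 2 * q - 2" by simp
    ultimately show ?thesis
      using q by (elim DERIV_cong) (simp add: pot2_def field_simps)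
  qed
  show "0 < pot2 q u" if "0 < u" for u
    unfolding pot2_def using that q by (intro add_pos_pos mult_pos_pos divide_pos_pos) auto
  show "0 < argmin_pot q" unfolding argmin_pot_def using q by simp
  have e: "(- 1 / (2 * q + 2)) * (- 2 * q - 1) = 1 + (- 1 / (2 * q + 2))"
    using q by (simp add: divide_simps)
  have "argmin_pot q powr (- 2 * q - 1) = q * argmin_pot q"
    unfolding argmin_pot_def powr_powr e powr_add using q by simp
  then show "pot1 q (argmin_pot q) = 0" using q by (simp add: pot1_def)
  show "filterlim (pot q) at_top (at_right 0)"
    unfolding pot_def using q by real_asymp
  show "filterlim (pot q) at_top at_top"
    unfolding pot_def using q by real_asymp
qed

section \<open>The total angle per period: value at rest, continuity, outer bound\<close>

context power_well
begin

abbreviation "um \<equiv> argmin_pot q"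

lemma um_powr: "um powr (- q - 1) = sqrt q" "um powr (- 2 * q - 2) = q" "um powr (- 2 * q) = q * um\<^sup>2"
proof -
  have "(- 1 / (2 * q + 2)) * (- q - 1) = 1 / 2" using q_pos by (simp add: field_simps)
  then show "um powr (- q - 1) = sqrt q"
    unfolding argmin_pot_def using q_pos by (simp only: powr_powr powr_half_sqrt)
  have "(- 1 / (2 * q + 2)) * (- 2 * q - 2) = 1" using q_pos by (simp add: divide_simps)
  then show *: "um powr (- 2 * q - 2) = q"
    unfolding argmin_pot_def using q_pos by (simp only: powr_powr powr_one)
  have "um powr ((- 2 * q - 2) + 2) = um powr (- 2 * q - 2) * um powr 2" by (rule powr_add)
  also have "\<dots> = q * um\<^sup>2" unfolding * using u0_pos by simp
  finally show "um powr (- 2 * q) = q * um\<^sup>2" by (simp only: diff_add_cancel)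
qed

lemma pot_um: "pot q um = um\<^sup>2 * (q + 1) / q"
  unfolding pot_def um_powr(3) using q_pos by (simp add: power2_eq_square field_simps)

lemma dw_um: "dw um = sqrt (2 * (q + 1))"
proof -
  have "pot2 q um = 4 * (q + 1)" using q_pos um_powr(2) by (simp add: pot2_def)
  then show ?thesis by (simp add: dw_def)
qed

lemma pot_gt_sq: "0 < u \<Longrightarrow> u\<^sup>2 < pot q u"
  using q_pos by (simp add: pot_def)

text \<open>Keeps the denominator of \<open>rate\<close> positive along the motion; geometrically,
  the curve avoids the poles of its axis.\<close>

lemma sq_lt_energy: "(h (R * sin \<psi>))\<^sup>2 < pot q um + R\<^sup>2"
proof -
  have "(R * sin \<psi>)\<^sup>2 \<le> R\<^sup>2 * 1"
    unfolding power_mult_distrib by (intro mult_left_mono) (auto simp: abs_square_le_1)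
  then show ?thesis
    using pot_gt_sq[OF h_pos[of "R * sin \<psi>"]] V_h[of "R * sin \<psi>"] by simp
qed

lemma rate_cont: "0 < u \<Longrightarrow> u\<^sup>2 < E \<Longrightarrow> isCont (rate q E) u"
  unfolding rate_def using q_pos by (intro continuous_intros) auto

lemma rate_cont_range:
  "E = pot q um + R\<^sup>2 \<Longrightarrow> u \<in> range (\<lambda>\<psi>. h (R * sin \<psi>)) \<Longrightarrow> isCont (rate q E) u"
  using rate_cont h_pos sq_lt_energy by force

definition total_angle :: "real \<Rightarrow> real" where
  "total_angle R = advance (rate q (pot q um + R\<^sup>2)) R"

text \<open>At rest the integrand is constant: the rate is \<open>sqrt (q + 1)\<close> and the phase
  speed \<open>sqrt (2 * (q + 1))\<close>, so the dependence on \<open>q\<close> cancels.\<close>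

lemma total_angle_0: "total_angle 0 = sqrt 2 * pi"
proof -
  have "h 0 = um" using h_w[OF u0_pos] by simp
  then have "total_angle 0 = 2 * pi * (rate q (pot q um) um / sqrt (2 * (q + 1)))"
    by (simp add: total_angle_def advance_def g_def dw_um inverse_eq_divide)
  also have "rate q (pot q um) um = sqrt (q + 1)"
  proof -
    have "pot q um - um\<^sup>2 = um\<^sup>2 / q" using q_pos by (simp add: pot_um field_simps)
    moreover have "sqrt (pot q um) = um * sqrt ((q + 1) / q)"
      using u0_pos by (simp add: pot_um real_sqrt_mult real_sqrt_divide)
    ultimately have "rate q (pot q um) um = sqrt ((q + 1) / q) * (um powr (- q) / um)"
      using q_pos u0_pos by (simp add: rate_def power2_eq_square)
    also have "um powr (- q) / um = sqrt q"
      using um_powr(1) u0_pos by (simp add: powr_diff)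
    finally show ?thesis using q_pos by (simp add: real_sqrt_divide)
  qed
  also have "2 * pi * (sqrt (q + 1) / sqrt (2 * (q + 1))) = sqrt 2 * pi"
    unfolding real_sqrt_mult using q_pos real_div_sqrt[of 2] by (simp add: field_simps)
  finally show ?thesis .
qed

text \<open>In the phase variable the integrand is jointly continuous in amplitude and phase, also
  at amplitude 0 where the turning points merge.\<close>

lemma total_angle_cont: "continuous_on UNIV total_angle"
proof -
  have hc: "continuous_on UNIV h" and gc: "continuous_on UNIV g"
    using h_cont g_cont by (auto intro!: continuous_at_imp_continuous_on)
  have ne: "q * (pot q um + (fst x)\<^sup>2 - (h (fst x * sin (snd x)))\<^sup>2) \<noteq> 0" for x :: "real \<times> real"
    using sq_lt_energy[of "fst x" "snd x"] q_pos by simp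
  have "continuous_on (UNIV \<times> cbox 0 (2 * pi)) (\<lambda>(R, \<psi>). rate q (pot q um + R\<^sup>2) (h (R * sin \<psi>)) * g (R * sin \<psi>))"
    unfolding rate_def split_beta
    using ne h_pos
    by (intro continuous_intros continuous_on_compose2[OF hc] continuous_on_compose2[OF gc] ballI)
       (auto simp: less_imp_neq[symmetric])
  from integral_continuous_on_param[OF this]
  show ?thesis by (simp add: total_angle_def[abs_def] advance_def cbox_interval)
qed

text \<open>
  In terms of \<open>t\<close> the angle element is
  \<open>sqrt E * u / ((q + 1) * u\<^sup>2 - q * E)\<close> times the differential of \<open>arcsin t\<close>, and the first factor
  decreases in \<open>u\<close>, which gives its value at \<open>u = x * sqrt E\<close> as the constant.
\<close>

lemma outer_angle_bound:
  assumes "0 < x" "x < 1" and A: "0 < (q + 1) * x\<^sup>2 - q" and "0 < E"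
    and b: "x * sqrt E < b" and Vb: "pot q b = E"
    and V: "\<And>u. u \<in> {x * sqrt E..<b} \<Longrightarrow> pot q u < E"
    and P: "continuous_on {x * sqrt E..b} P"
      "\<And>u. u \<in> {x * sqrt E<..<b} \<Longrightarrow> (P has_real_derivative rate q E u / sqrt (E - pot q u)) (at u)"
  shows "P b - P (x * sqrt E) \<le> x / ((q + 1) * x\<^sup>2 - q) * (pi / 2)"
proof -
  define a where "a = x * sqrt E"
  define k where "k = x / ((q + 1) * x\<^sup>2 - q)"
  define t where "t u = u powr (- q) / (q * sqrt (E - u\<^sup>2))" for u
  have a: "0 < a" using assms by (simp add: a_def)
  have k: "0 < k" using assms by (simp add: k_def)
  have Vle: "pot q u \<le> E" if "u \<in> {a..b}" for u
    using V[of u] that Vb by (cases "u = b") (auto simp: a_def)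
  have sq: "u\<^sup>2 < E" if "u \<in> {a..b}" for u
    using Vle[OF that] pot_gt_sq[of u] that a by auto
  \<comment> \<open>The factor \<open>E - pot q u\<close> shows that \<open>t\<close> stays at most
    1 and equals 1 at the turning point \<open>b\<close>.\<close>
  have t1: "1 - (t u)\<^sup>2 = (E - pot q u) / (E - u\<^sup>2)" if "u \<in> {a..b}" for u
  proof -
    have "(u powr (- q))\<^sup>2 = u powr (- 2 * q)" using that a by (simp add: powr_power)
    then have "(t u)\<^sup>2 = u powr (- 2 * q) / (q\<^sup>2 * (E - u\<^sup>2))"
      using sq[OF that] by (simp add: t_def power_divide power_mult_distrib)
    moreover define c where "c = E - u\<^sup>2"
    ultimately have "(t u)\<^sup>2 = u powr (- 2 * q) / q\<^sup>2 / c" "E - pot q u = c - u powr (- 2 * q) / q\<^sup>2"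
      by (auto simp: pot_def)
    moreover have "0 < c" using sq[OF that] by (simp add: c_def)
    ultimately show ?thesis unfolding c_def[symmetric] by (simp add: diff_divide_distrib)
  qed
  have t0: "0 \<le> t u" if "u \<in> {a..b}" for u
    using sq[OF that] q_pos by (simp add: t_def)
  have tle: "t u \<le> 1" if "u \<in> {a..b}" for u
  proof -
    have "(t u)\<^sup>2 \<le> 1\<^sup>2" using t1[OF that] Vle[OF that] sq[OF that]
      by (smt (verit) divide_nonneg_pos one_power2)
    then show ?thesis by (rule power2_le_imp_le) simp
  qed
  \<comment> \<open>Integral comparison in derivative form: \<open>k * arcsin t - P\<close> is
    continuous up to the singular endpoint \<open>b\<close> and nondecreasing inside.\<close>
  have "k * arcsin (t a) - P a \<le> k * arcsin (t b) - P b"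
  proof (rule DERIV_nonneg_imp_increasing_open[where f = "\<lambda>u. k * arcsin (t u) - P u"])
    show "a \<le> b" using b by (simp add: a_def)
    have "continuous_on {a..b} t"
      unfolding t_def using sq q_pos a by (intro continuous_intros ballI) (auto simp: less_imp_neq)
    then have "continuous_on {a..b} (\<lambda>u. arcsin (t u))"
      by (rule continuous_on_arcsin) (use t0 tle in \<open>force\<close>)
    then show "continuous_on {a..b} (\<lambda>u. k * arcsin (t u) - P u)"
      using P(1) by (intro continuous_on_diff continuous_on_mult continuous_on_const) (auto simp: a_def)
    fix u assume u: "a < u" "u < b"
    then have u': "u \<in> {a..b}" "0 < u" using a by auto
    define D where "D = E - pot q u"
    define c where "c = E - u\<^sup>2"
    have D: "0 < D" using V[of u] u by (simp add: D_def a_def)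
    have c: "0 < c" using sq[OF u'(1)] by (simp add: c_def)
    have s1: "sqrt (1 - (t u)\<^sup>2) = sqrt D / sqrt c"
      by (simp add: t1[OF u'(1)] D_def c_def real_sqrt_divide)
    have tpos: "0 < t u" using c u' q_pos by (simp add: t_def c_def)
    have "(t has_real_derivative t u * ((q + 1) * u\<^sup>2 - q * E) / (u * c)) (at u)"
    proof -
      have "(t has_real_derivative
          ((- q * u powr (- q - 1)) * (q * sqrt c) - u powr (- q) * (q * (- u / sqrt c))) / (q * sqrt c)\<^sup>2) (at u)"
        unfolding t_def using u' c q_pos
        by (auto intro!: derivative_eq_intros simp: c_def power2_eq_square field_simps)
      also have "((- q * u powr (- q - 1)) * (q * sqrt c) - u powr (- q) * (q * (- u / sqrt c))) / (q * sqrt c)\<^sup>2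
          = t u * ((q + 1) * u\<^sup>2 - q * E) / (u * c)"
      proof -
        define y where "y = u powr (- q)"
        define r where "r = sqrt c"
        have r: "0 < r" "c = r * r" using c by (auto simp: r_def)
        have E: "E = r * r + u * u" using r(2) by (simp add: c_def power2_eq_square)
        have y: "u powr (- q - 1) = y / u" using u' by (simp add: y_def powr_diff)
        have t: "t u = y / (q * r)" by (simp add: t_def y_def r_def c_def)
        show ?thesis
          using \<open>0 < r\<close> u'(2) q_pos unfolding y t r_def[symmetric] y_def[symmetric] r(2) E
          by (simp add: divide_simps power2_eq_square) (simp add: algebra_simps)
      qed
      finally show ?thesis .
    qed
    then have d1: "((\<lambda>u. k * arcsin (t u) - P u) has_real_derivative
        k * (inverse (sqrt (1 - (t u)\<^sup>2)) * (t u * ((q + 1) * u\<^sup>2 - q * E) / (u * c)))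
          - rate q E u / sqrt D) (at u)"
      using P(2)[of u] u t1[OF u'(1)] tpos D c
      by (intro DERIV_diff DERIV_cmult DERIV_chain2[OF DERIV_arcsin])
         (auto simp: a_def D_def, smt (verit) c_def divide_pos_pos one_power2 power2_less_imp_less)
    have r: "rate q E u = sqrt E * t u / sqrt c"
    proof -
      have "sqrt c * sqrt c = c" using c by simp
      then show ?thesis by (simp add: rate_def t_def c_def[symmetric] mult.assoc)
    qed
    have main: "sqrt E * u \<le> k * ((q + 1) * u\<^sup>2 - q * E)"
    proof -
      define A where "A = (q + 1) * x\<^sup>2 - q"
      define s where "s = sqrt E"
      have s: "0 < s" "E = s\<^sup>2" using \<open>0 < E\<close> by (auto simp: s_def)
      \<comment> \<open>The difference factors with a zero at the left end
        \<open>u = x * sqrt E\<close>, where the inequality is an equality.\<close>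
      have "x * ((q + 1) * u\<^sup>2 - q * s\<^sup>2) - s * u * A = (u - x * s) * ((q + 1) * x * u + q * s)"
        by (simp add: A_def algebra_simps power2_eq_square)
      also have "\<dots> \<ge> 0"
      proof (rule mult_nonneg_nonneg)
        show "0 \<le> u - x * s" using u by (simp add: a_def s_def)
        show "0 \<le> (q + 1) * x * u + q * s" using u'(2) s(1) assms(1) q_pos by simp
      qed
      finally have "s * u * A \<le> x * ((q + 1) * u\<^sup>2 - q * s\<^sup>2)" by simp
      moreover have "0 < A" using A by (simp add: A_def)
      ultimately show ?thesis unfolding k_def A_def[symmetric] s_def[symmetric] s(2) using s(1) by (simp add: field_simps)
    qed
    have "k * (inverse (sqrt (1 - (t u)\<^sup>2)) * (t u * ((q + 1) * u\<^sup>2 - q * E) / (u * c)))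
          - rate q E u / sqrt D
        = t u / (sqrt c * sqrt D * u) * (k * ((q + 1) * u\<^sup>2 - q * E) - sqrt E * u)"
    proof -
      define r where "r = sqrt c"
      have "0 < r" "c = r * r" using c by (auto simp: r_def)
      then show ?thesis using u' D unfolding s1 r r_def[symmetric]
        by (simp add: divide_simps) (simp add: algebra_simps)
    qed
    also have "\<dots> \<ge> 0"
      using main tpos c D u' by (intro mult_nonneg_nonneg) auto
    finally show "\<exists>y. ((\<lambda>u. k * arcsin (t u) - P u) has_real_derivative y) (at u) \<and> 0 \<le> y"
      using d1 by blast
  qed
  moreover have "0 \<le> k * arcsin (t a)"
    using t0[of a] tle[of a] b k by (intro mult_nonneg_nonneg) (auto simp: a_def arcsin_nonneg)
  moreover have "k * arcsin (t b) \<le> k * (pi / 2)"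
    using t0[of b] tle[of b] b k by (intro mult_left_mono arcsin_ubound) (auto simp: a_def)
  ultimately show ?thesis by (simp add: a_def k_def)
qed

end

section \<open>The angular progression at high energy\<close>

context power_well
begin

lemma pot_convex: "convex_on {0<..} (pot q)"
  by (rule f''_ge0_imp_convex[where f' = "pot1 q" and f'' = "pot2 q"])
     (auto simp: V_deriv V1_deriv V2_pos less_imp_le)

lemma pot_chord:
  assumes "0 < a" "a < b" "a < u" "u \<le> b"
  shows "(b - a) * pot q u \<le> (b - u) * pot q a + (u - a) * pot q b"
proof -
  define t where "t = (u - a) / (b - a)"
  have t: "0 \<le> t" "t \<le> 1" using assms by (auto simp: t_def field_simps)
  have t': "(b - a) * t = u - a" using assms by (simp add: t_def)
  then have u: "(1 - t) *\<^sub>R a + t *\<^sub>R b = u" by (simp add: algebra_simps)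
  have "pot q u \<le> (1 - t) * pot q a + t * pot q b"
    using convex_onD[OF pot_convex t, of a b] assms unfolding u by simp
  then have "(b - a) * pot q u \<le> (b - a) * ((1 - t) * pot q a + t * pot q b)"
    using assms by (intro mult_left_mono) auto
  also have "\<dots> = ((b - a) - (b - a) * t) * pot q a + (b - a) * t * pot q b"
    by (simp add: algebra_simps)
  also have "\<dots> = (b - u) * pot q a + (u - a) * pot q b" unfolding t' by simp
  finally show ?thesis .
qed

text \<open>
  Concavity of \<open>E - V\<close> bounds it below by a multiple of \<open>u - a\<close>, and
  \<open>(a / u) powr q \<le> a powr r * (u - a) powr (- r)\<close>; choosing \<open>r \<le> 1 / 4\<close> keeps the resulting
  singularity \<open>(u - a) powr (- 1 / 2 - r)\<close> integrable.
\<close>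

lemma inner_angle_bound:
  assumes x: "0 < x" "x < 1" and E: "1 \<le> x\<^sup>2 * E" "2 \<le> q\<^sup>2 * (1 - x\<^sup>2) * E"
    and r: "0 < r" "r \<le> q" "r \<le> 1 / 4"
    and a: "0 < a" "a < x * sqrt E" and Va: "pot q a = E"
    and P: "continuous_on {a..x * sqrt E} P"
      "\<And>u. u \<in> {a<..<x * sqrt E} \<Longrightarrow> (P has_real_derivative rate q E u / sqrt (E - pot q u)) (at u)"
  shows "P (x * sqrt E) - P a \<le> 4 * sqrt 2 / sqrt (1 - x\<^sup>2) ^ 3 * (a powr r * E powr (- r / 2))"
proof -
  define b where "b = x * sqrt E"
  define c where "c = sqrt (1 - x\<^sup>2)"
  have x2: "x\<^sup>2 < 1" using x by (simp add: power_less_one_iff)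
  have c: "0 < c" "c\<^sup>2 = 1 - x\<^sup>2" using x2 by (auto simp: c_def)
  have E0: "0 < E" using E(1) x zero_less_mult_pos[of "x\<^sup>2" E] by simp
  have b: "a < b" "0 < b" using a by (auto simp: b_def)
  have b2: "b\<^sup>2 = x\<^sup>2 * E" using E0 by (simp add: b_def power_mult_distrib)
  have bE: "b \<le> sqrt E" using x E0 by (simp add: b_def)
  have "1 \<le> b\<^sup>2" using b2 E(1) by simp
  then have b1: "1 \<le> b" using b abs_le_square_iff[of 1 b] by simp
  have Ec: "E * c\<^sup>2 = E - x\<^sup>2 * E" unfolding c(2) by (simp add: algebra_simps)
  \<comment> \<open>At the dividing point the singular term of the potential is at most
    \<open>1 / q^2\<close>, which by the second size condition on \<open>E\<close> consumes at most
    half of \<open>E - b^2 = E * c^2\<close>.\<close>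
  have Db: "E * c\<^sup>2 / 2 \<le> E - pot q b"
  proof -
    have "b powr (- 2 * q) \<le> 1 powr (- 2 * q)" using b1 q_pos by (intro powr_mono2') auto
    then have "b powr (- 2 * q) / q\<^sup>2 \<le> 1 / q\<^sup>2" by (intro divide_right_mono) auto
    also have "1 / q\<^sup>2 \<le> E * c\<^sup>2 / 2" using E(2) q_pos by (simp add: c field_simps)
    finally have "b powr (- 2 * q) / q\<^sup>2 \<le> E * c\<^sup>2 / 2" .
    moreover have "pot q b = x\<^sup>2 * E + b powr (- 2 * q) / q\<^sup>2" unfolding pot_def b2 ..
    ultimately show ?thesis using Ec by linarith
  qed
  \<comment> \<open>\<open>E - pot q u\<close> vanishes at \<open>a\<close> and is at least
    \<open>E * c^2 / 2\<close> at \<open>b\<close>, so by concavity it lies above the corresponding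
    chord; \<open>b - a \<le> sqrt E\<close> makes the slope explicit.\<close>
  have D: "sqrt E * c\<^sup>2 / 2 * (u - a) \<le> E - pot q u" if "a < u" "u < b" for u
  proof -
    have "sqrt E * (sqrt E * c\<^sup>2 / 2 * (u - a)) = (u - a) * (E * c\<^sup>2 / 2)" using E0 by simp
    also have "\<dots> \<le> (u - a) * (E - pot q b)" using Db that by (intro mult_left_mono) auto
    also have "\<dots> \<le> (b - a) * (E - pot q u)"
      using pot_chord[of a b u] that a Va by (simp add: algebra_simps)
    finally have *: "sqrt E * (sqrt E * c\<^sup>2 / 2 * (u - a)) \<le> (b - a) * (E - pot q u)" .
    have "0 \<le> sqrt E * (sqrt E * c\<^sup>2 / 2 * (u - a))" using that E0 by simp
    with * have "0 \<le> (b - a) * (E - pot q u)" by linarith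
    then have "0 \<le> E - pot q u" using b by (simp add: zero_le_mult_iff)
    then have "(b - a) * (E - pot q u) \<le> sqrt E * (E - pot q u)"
      using bE a by (intro mult_right_mono) auto
    with * have "sqrt E * (sqrt E * c\<^sup>2 / 2 * (u - a)) \<le> sqrt E * (E - pot q u)" by linarith
    then show ?thesis using E0 by simp
  qed
  \<comment> \<open>Since \<open>pot q a = E\<close>, the factor \<open>a powr (- q)\<close> is at
    most \<open>q * sqrt E\<close>. The decay of \<open>(a / u) powr q\<close> is then weakened to
    the exponent \<open>r\<close>.\<close>
  have ua: "u powr (- q) \<le> q * sqrt E * (a powr r * (u - a) powr (- r))" if "a < u" for u
  proof -
    have "(a powr (- q))\<^sup>2 \<le> (q * sqrt E)\<^sup>2"
    proof -
      have "(a powr (- q))\<^sup>2 = a powr (- 2 * q)" using a by (simp add: powr_power)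
      also have "\<dots> = q\<^sup>2 * (pot q a - a\<^sup>2)" using q_pos by (simp add: pot_def)
      also have "\<dots> \<le> q\<^sup>2 * E" unfolding Va by (intro mult_left_mono) auto
      finally show ?thesis using E0 by (simp add: power_mult_distrib)
    qed
    then have aq: "a powr (- q) \<le> q * sqrt E"
      by (rule power2_le_imp_le) (use q_pos E0 in simp)
    have "u powr (- q) = a powr (- q) * (a / u) powr q"
      using a that by (simp add: powr_divide powr_minus field_simps)
    also have "\<dots> \<le> q * sqrt E * (a / u) powr r"
      using aq a that r by (intro mult_mono powr_mono') (auto simp: q_pos less_imp_le E0)
    also have "(a / u) powr r = a powr r * u powr (- r)"
      using a that by (simp add: powr_divide powr_minus field_simps)
    also have "q * sqrt E * (a powr r * u powr (- r)) \<le> q * sqrt E * (a powr r * (u - a) powr (- r))"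
      using a that r q_pos E0 by (intro mult_left_mono powr_mono2') auto
    finally show ?thesis .
  qed
  define K where "K = sqrt 2 / c ^ 3 * a powr r * E powr (- 1 / 4)"
  have K: "0 < K" using c a E0 by (simp add: K_def)
  have rate_le: "rate q E u / sqrt (E - pot q u) \<le> K * (u - a) powr (1 / 2 - r - 1)" if u: "a < u" "u < b" for u
  proof -
    have Eu: "E * c\<^sup>2 \<le> E - u\<^sup>2"
    proof -
      have "u\<^sup>2 \<le> b\<^sup>2" using u a by (intro power_mono) auto
      then show ?thesis using b2 Ec by linarith
    qed
    \<comment> \<open>The powers of \<open>E\<close> in this estimate are integer powers of its
      fourth root.\<close>
    define e where "e = E powr (1 / 4)"
    have e: "0 < e" "E powr (- 1 / 4) = 1 / e" "sqrt E = e\<^sup>2" "E = e ^ 4"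
      using E0 by (auto simp: e_def powr_minus_divide powr_power powr_half_sqrt[symmetric])
    have "rate q E u = sqrt E * u powr (- q) / q / (E - u\<^sup>2)" by (simp add: rate_def)
    also have "\<dots> \<le> (E * (a powr r * (u - a) powr (- r))) / (E * c\<^sup>2)"
    proof (rule frac_le)
      have "sqrt E * u powr (- q) / q \<le> sqrt E * (q * sqrt E * (a powr r * (u - a) powr (- r))) / q"
        using ua[OF u(1)] q_pos E0 by (intro divide_right_mono mult_left_mono) auto
      also have "\<dots> = (sqrt E * sqrt E) * (a powr r * (u - a) powr (- r))" using q_pos by simp
      finally show "sqrt E * u powr (- q) / q \<le> E * (a powr r * (u - a) powr (- r))" using E0 by simp
    qed (use Eu E0 c(1) in auto)
    also have "\<dots> = a powr r * (u - a) powr (- r) / c\<^sup>2" using E0 by simp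
    finally have 1: "rate q E u \<le> a powr r * (u - a) powr (- r) / c\<^sup>2" .
    have 2: "e * c / sqrt 2 * (u - a) powr (1 / 2) \<le> sqrt (E - pot q u)"
    proof -
      have "sqrt (sqrt E * c\<^sup>2 / 2 * (u - a)) = e * c / sqrt 2 * (u - a) powr (1 / 2)"
        using e(1) c(1) u by (simp add: e(3) real_sqrt_mult real_sqrt_divide powr_half_sqrt)
      then show ?thesis using real_sqrt_le_mono[OF D[OF u]] by simp
    qed
    have "rate q E u / sqrt (E - pot q u)
        \<le> (a powr r * (u - a) powr (- r) / c\<^sup>2) / (e * c / sqrt 2 * (u - a) powr (1 / 2))"
      using 1 2 e(1) c(1) u by (intro frac_le) auto
    also have "\<dots> = K * ((u - a) powr (- r) / (u - a) powr (1 / 2))"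
      using c(1) e(1) unfolding K_def e(2) by (simp add: field_simps power3_eq_cube power2_eq_square)
    also have "(u - a) powr (- r) / (u - a) powr (1 / 2) = (u - a) powr (1 / 2 - r - 1)"
      unfolding powr_diff[symmetric] by (rule arg_cong[where f = "\<lambda>z. (u - a) powr z"]) simp
    finally show ?thesis .
  qed
  \<comment> \<open>Integrating the majorant gives \<open>K / s * (u - a) powr s\<close>;
    \<open>r \<le> 1 / 4\<close> yields \<open>s \<ge> 1 / 4\<close>, hence the factor 4 in the
    bound.\<close>
  define s where "s = 1 / 2 - r"
  have s: "1 / 4 \<le> s" using r by (simp add: s_def)
  have "K / s * (a - a) powr s - P a \<le> K / s * (b - a) powr s - P b"
  proof (rule DERIV_nonneg_imp_increasing_open[where f = "\<lambda>u. K / s * (u - a) powr s - P u"])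
    show "a \<le> b" using b by simp
    have "continuous_on {a..b} (\<lambda>u. (u - a) powr s)"
      using s by (intro continuous_on_powr' continuous_intros) auto
    then show "continuous_on {a..b} (\<lambda>u. K / s * (u - a) powr s - P u)"
      using P(1) by (intro continuous_on_diff continuous_on_mult continuous_on_const) (auto simp: b_def)
    fix u assume u: "a < u" "u < b"
    have "((\<lambda>u. (u - a) powr s) has_real_derivative s * (u - a) powr (s - 1) * (1 - 0)) (at u)"
      using u by (intro DERIV_chain2[where f = "\<lambda>z. z powr s"] has_real_derivative_powr
          DERIV_diff DERIV_ident DERIV_const) auto
    then have "((\<lambda>u. K / s * (u - a) powr s - P u) has_real_derivative
        K / s * (s * (u - a) powr (s - 1) * (1 - 0)) - rate q E u / sqrt (E - pot q u)) (at u)"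
      using P(2)[of u] u by (intro DERIV_diff DERIV_cmult) (auto simp: b_def)
    moreover have "0 \<le> K / s * (s * (u - a) powr (s - 1) * (1 - 0)) - rate q E u / sqrt (E - pot q u)"
      using rate_le[OF u] s by (simp add: s_def)
    ultimately show "\<exists>y. ((\<lambda>u. K / s * (u - a) powr s - P u) has_real_derivative y) (at u) \<and> 0 \<le> y"
      by blast
  qed
  then have "P b - P a \<le> K / s * (b - a) powr s" using s by simp
  also have "\<dots> \<le> K * 4 * (sqrt E powr s)"
  proof (rule mult_mono)
    have "1 / s \<le> 1 / (1 / 4)" using s by (intro divide_left_mono) auto
    then have "K * (1 / s) \<le> K * 4" using K by (intro mult_left_mono) auto
    then show "K / s \<le> K * 4" by simp
    show "(b - a) powr s \<le> sqrt E powr s" using b bE a s by (intro powr_mono2) auto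
  qed (use K in auto)
  also have "\<dots> = 4 * sqrt 2 / c ^ 3 * (a powr r * E powr (- r / 2))"
  proof -
    have "E powr (- 1 / 4) * (sqrt E powr s) = E powr (- r / 2)"
      using E0 by (simp add: powr_half_sqrt[symmetric] powr_powr powr_add[symmetric] s_def field_simps)
    then show ?thesis by (simp add: K_def mult.assoc)
  qed
  finally show ?thesis by (simp add: b_def c_def)
qed

text \<open>The order of choices matters: first \<open>x\<close> near 1, making the outer piece
  smaller than pi/2 + \<delta>/4, then \<open>E\<close> large depending on \<open>x\<close>, making
  the inner piece smaller than \<delta>/4. Twice their sum is below pi + \<delta>.\<close>

lemma total_angle_near_pi:
  assumes "0 < \<delta>"
  shows "\<exists>R>0. total_angle R < pi + \<delta>"
proof -
  define k where "k x = x / ((q + 1) * x\<^sup>2 - q)" for x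
  have "isCont k 1" unfolding k_def by (intro continuous_intros) auto
  then have "(k \<longlongrightarrow> 1) (at_left 1)"
    by (simp add: isCont_def k_def filterlim_at_split)
  moreover have "1 < 1 + \<delta> / (2 * pi)" using assms by simp
  ultimately have "\<forall>\<^sub>F x in at_left 1. k x < 1 + \<delta> / (2 * pi)"
    by (rule order_tendstoD)
  moreover have "((\<lambda>x. (q + 1) * x\<^sup>2 - q) \<longlongrightarrow> (q + 1) * 1\<^sup>2 - q) (at_left 1)"
    by (intro tendsto_intros)
  then have "\<forall>\<^sub>F x in at_left 1. 0 < (q + 1) * x\<^sup>2 - q"
    by (rule order_tendstoD) simp
  moreover have "\<forall>\<^sub>F x in at_left 1. x \<in> {0<..<1::real}"
    by (rule eventually_at_left_real) simp
  ultimately have "\<forall>\<^sub>F x in at_left 1. k x < 1 + \<delta> / (2 * pi) \<and> 0 < (q + 1) * x\<^sup>2 - q \<and> x \<in> {0<..<1}"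
    by eventually_elim auto
  then obtain x where x: "0 < x" "x < 1" "0 < (q + 1) * x\<^sup>2 - q" "k x < 1 + \<delta> / (2 * pi)"
    using eventually_happens[of _ "at_left (1::real)"] by (auto simp: trivial_limit_at_left_real)
  have x2: "x\<^sup>2 < 1" using x by (simp add: power_less_one_iff)
  define r where "r = min q (1 / 4)"
  have r: "0 < r" "r \<le> q" "r \<le> 1 / 4" using q_pos by (auto simp: r_def)
  \<comment> \<open>The inner turning point \<open>a\<close> moves with \<open>E\<close>; replacing
    it by the larger \<open>um\<close> gives a constant independent of \<open>E\<close>.\<close>
  define C where "C = 4 * sqrt 2 / sqrt (1 - x\<^sup>2) ^ 3 * um powr r"
  have C: "0 \<le> C" using x2 by (simp add: C_def)
  have "((\<lambda>E. C * E powr (- r / 2)) \<longlongrightarrow> C * 0) at_top"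
    using r by (intro tendsto_intros tendsto_neg_powr filterlim_ident) auto
  then have "\<forall>\<^sub>F E in at_top. C * E powr (- r / 2) < \<delta> / 4"
    by (rule order_tendstoD) (use assms in simp)
  moreover have "\<forall>\<^sub>F E in at_top. max (1 / x\<^sup>2) (2 / (q\<^sup>2 * (1 - x\<^sup>2))) \<le> E" by (rule eventually_ge_at_top)
  \<comment> \<open>The first bound places the dividing point \<open>x * sqrt E\<close> to the right
    of \<open>um\<close>; the second makes the amplitude \<open>R\<close> positive.\<close>
  moreover have "\<forall>\<^sub>F E in at_top. max ((um / x)\<^sup>2) (pot q um) < E" by (rule eventually_gt_at_top)
  ultimately have "\<forall>\<^sub>F E in at_top. C * E powr (- r / 2) < \<delta> / 4 \<and> 1 / x\<^sup>2 \<le> E \<and> 2 / (q\<^sup>2 * (1 - x\<^sup>2)) \<le> E \<and>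
      (um / x)\<^sup>2 < E \<and> pot q um < E"
    by eventually_elim auto
  then obtain E where E: "C * E powr (- r / 2) < \<delta> / 4" "1 / x\<^sup>2 \<le> E" "2 / (q\<^sup>2 * (1 - x\<^sup>2)) \<le> E"
      "(um / x)\<^sup>2 < E" "pot q um < E"
    using eventually_happens[of _ "at_top :: real filter"] by auto
  define R where "R = sqrt (E - pot q um)"
  have R: "0 < R" "E = pot q um + R\<^sup>2" using E(5) by (auto simp: R_def)
  have E0: "0 < E" using pot_gt_sq[OF u0_pos] E(5) zero_le_power2[of um] by linarith
  obtain P where P: "continuous_on {h (- R)..h R} P"
    "\<And>u. u \<in> {h (- R)<..<h R} \<Longrightarrow> (P has_real_derivative rate q E u / sqrt (R\<^sup>2 - (w u)\<^sup>2)) (at u)"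
    "total_angle R = 2 * (P (h R) - P (h (- R)))"
    using advance_half[OF R(1) rate_cont_range[OF R(2)]] unfolding total_angle_def R(2)[symmetric] by blast
  have P': "(P has_real_derivative rate q E u / sqrt (E - pot q u)) (at u)" if "u \<in> {h (- R)<..<h R}" for u
  proof -
    have "0 < u" using that h_pos[of "- R"] by simp
    then show ?thesis using P(2)[OF that] V_conv_w[of u] R(2) by simp
  qed
  have h0: "h 0 = um" using h_w[OF u0_pos] by simp
  define a where "a = h (- R)"
  define b where "b = h R"
  have a: "0 < a" "a < um" using h_pos h_strict_mono[of "- R" 0] R(1) h0 by (auto simp: a_def)
  have Va: "pot q a = E" and Vb: "pot q b = E" using V_h R(2) by (auto simp: a_def b_def)
  define c where "c = x * sqrt E"
  have "um / x < sqrt E" using E(4) real_less_rsqrt by blast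
  then have uc: "um < c" using x by (simp add: c_def field_simps)
  have xE: "1 \<le> x\<^sup>2 * E" "2 \<le> q\<^sup>2 * (1 - x\<^sup>2) * E"
    using E(2,3) x x2 q_pos by (auto simp: field_simps)
  have cpow: "pot q c < E"
  proof -
    have c2: "c\<^sup>2 = x\<^sup>2 * E" using E0 by (simp add: c_def power_mult_distrib)
    then have "1 \<le> c\<^sup>2" using xE by simp
    moreover have "0 < c" using uc u0_pos by simp
    ultimately have "1 \<le> c" using abs_le_square_iff[of 1 c] by simp
    then have "c powr (- 2 * q) \<le> 1 powr (- 2 * q)" using q_pos by (intro powr_mono2') auto
    then have "c powr (- 2 * q) / q\<^sup>2 \<le> 1 / q\<^sup>2" by (intro divide_right_mono) auto
    also have "1 / q\<^sup>2 < (1 - x\<^sup>2) * E"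
    proof -
      have "1 < q\<^sup>2 * ((1 - x\<^sup>2) * E)" using xE(2) by (simp add: mult.assoc)
      then show ?thesis using q_pos by (simp add: field_simps)
    qed
    finally show ?thesis using c2 by (simp add: pot_def algebra_simps)
  qed
  have cb: "c < b"
  proof -
    have "(w c)\<^sup>2 < R\<^sup>2" using cpow V_conv_w[of c] uc u0_pos R(2) by simp
    then have "w c < R" using R(1) power_less_imp_less_base by (smt (verit) power_mono)
    then show ?thesis using h_strict_mono[of "w c" R] h_w[of c] uc u0_pos by (simp add: b_def)
  qed
  have inner: "P c - P a \<le> 4 * sqrt 2 / sqrt (1 - x\<^sup>2) ^ 3 * (a powr r * E powr (- r / 2))"
    unfolding c_def
  proof (rule inner_angle_bound[OF x(1,2) xE r a(1) _ Va])
    show "a < x * sqrt E" using a uc by (simp add: c_def)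
    show "continuous_on {a..x * sqrt E} P"
      using cb by (intro continuous_on_subset[OF P(1)]) (auto simp: a_def b_def c_def)
    show "(P has_real_derivative rate q E u / sqrt (E - pot q u)) (at u)" if "u \<in> {a<..<x * sqrt E}" for u
      using that cb by (intro P') (auto simp: a_def b_def c_def)
  qed
  also have "\<dots> \<le> 4 * sqrt 2 / sqrt (1 - x\<^sup>2) ^ 3 * (um powr r * E powr (- r / 2))"
    using a r x2 by (intro mult_left_mono mult_right_mono powr_mono2) auto
  also have "\<dots> < \<delta> / 4" using E(1) by (simp add: C_def mult.assoc)
  finally have 1: "P c - P a < \<delta> / 4" .
  have 2: "P b - P c \<le> k x * (pi / 2)"
    unfolding c_def k_def
  proof (rule outer_angle_bound[OF x(1,2,3) E0 _ Vb])
    show "x * sqrt E < b" using cb by (simp add: c_def)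
    show "pot q u < E" if "u \<in> {x * sqrt E..<b}" for u
    proof -
      have u: "um < u" using that uc by (simp add: c_def)
      then have "w u < w b" using w_strict_mono[of u b] u0_pos that by simp
      then have "(w u)\<^sup>2 < (w b)\<^sup>2" using w_pos[OF u] by (intro power_strict_mono) auto
      then show ?thesis using V_conv_w[of u] u u0_pos R(2) by (simp add: b_def)
    qed
    show "continuous_on {x * sqrt E..b} P"
      using a uc by (intro continuous_on_subset[OF P(1)]) (auto simp: a_def b_def c_def)
    show "(P has_real_derivative rate q E u / sqrt (E - pot q u)) (at u)" if "u \<in> {x * sqrt E<..<b}" for u
      using that a uc by (intro P') (auto simp: a_def b_def c_def)
  qed
  also have "\<dots> < (1 + \<delta> / (2 * pi)) * (pi / 2)" using x(4) by (intro mult_strict_right_mono) auto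
  also have "\<dots> = pi / 2 + \<delta> / 4" by (simp add: field_simps)
  finally have "total_angle R < pi + \<delta>" using 1 P(3) by (simp add: a_def b_def)
  then show ?thesis using R(1) by blast
qed

lemma total_angle_attains:
  assumes "pi < y" "y < sqrt 2 * pi"
  obtains R where "0 < R" "total_angle R = y"
proof -
  obtain R where R: "0 < R" "total_angle R < y"
    using total_angle_near_pi[of "y - pi"] assms by auto
  \<comment> \<open>The total angle is \<open>sqrt 2 * pi\<close> at 0 and below \<open>y\<close> at
    \<open>R\<close>. The strict upper bound on \<open>y\<close> afterwards excludes
    \<open>r = 0\<close>.\<close>
  obtain r where r: "0 \<le> r" "r \<le> R" "total_angle r = y"
    using IVT2'[of total_angle R y 0] R assms total_angle_0 continuous_on_subset[OF total_angle_cont]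
    by auto
  then show ?thesis using that[of r] assms total_angle_0 by (cases "r = 0") auto
qed

end

section \<open>Curves on the sphere in coordinates about a fixed axis\<close>

lemma bounded_bilinear_cross3: "bounded_bilinear cross3"
  using bilinear_cross bilinear_conv_bounded_bilinear by blast

lemmas has_vector_derivative_cross3 = bounded_bilinear.has_vector_derivative[OF bounded_bilinear_cross3]

lemma has_vector_derivative_zero_imp_eq:
  fixes f :: "real \<Rightarrow> 'a::real_normed_vector"
  assumes "\<And>s. (f has_vector_derivative 0) (at s)"
  shows "f s = f t"
proof -
  obtain c where "\<And>x. x \<in> UNIV \<Longrightarrow> f x = c"
    using has_vector_derivative_zero_constant[of UNIV f] assms by auto
  then show ?thesis by simp
qed

lemma orthonormal_frame_cross:
  assumes "norm a = 1" "norm b = 1" "a \<bullet> b = 0"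
  shows "cross3 b (cross3 a b) = a" "cross3 (cross3 a b) a = b" "norm (cross3 a b) = 1"
    "cross3 a (cross3 a b) = - b" "cross3 (cross3 a b) b = - a"
proof -
  have aa: "a \<bullet> a = 1" "b \<bullet> b = 1" "b \<bullet> a = 0"
    using assms by (auto simp: dot_square_norm inner_commute)
  show "cross3 b (cross3 a b) = a" "cross3 a (cross3 a b) = - b"
    by (simp_all add: Lagrange aa assms)
  then show "cross3 (cross3 a b) a = b" "cross3 (cross3 a b) b = - a"
    by (simp_all add: cross_skew[of "cross3 a b"])
  have "(norm (cross3 a b))\<^sup>2 = 1" using assms by (simp add: norm_cross)
  then show "norm (cross3 a b) = 1" by (simp add: power2_eq_1_iff) (smt (verit) norm_ge_zero)
qed

text \<open>With \<open>c = cross3 a b\<close>, the double product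
  \<open>cross3 c (cross3 c v)\<close> is evaluated in two ways: Lagrange's formula gives the
  \<open>c\<close>-component minus \<open>v\<close>, and expanding \<open>cross3 c v\<close> first
  gives minus the projection to the plane of \<open>a\<close> and \<open>b\<close>.\<close>

lemma orthonormal_frame_expansion:
  assumes "norm a = 1" "norm b = 1" "a \<bullet> b = 0"
  shows "v = (v \<bullet> a) *\<^sub>R a + (v \<bullet> b) *\<^sub>R b + (v \<bullet> cross3 a b) *\<^sub>R cross3 a b"
proof -
  define c where "c = cross3 a b"
  have "cross3 c v = (v \<bullet> a) *\<^sub>R b - (v \<bullet> b) *\<^sub>R a"
    using Lagrange[of v a b] by (simp add: c_def cross_skew[of _ v])
  then have "cross3 c (cross3 c v) = - (v \<bullet> a) *\<^sub>R a - (v \<bullet> b) *\<^sub>R b"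
    using orthonormal_frame_cross[OF assms]
    by (simp add: c_def Cross3.right_diff_distrib cross_mult_right)
  moreover have "cross3 c (cross3 c v) = (v \<bullet> c) *\<^sub>R c - v"
    using orthonormal_frame_cross(3)[OF assms] by (simp add: Lagrange inner_commute dot_square_norm c_def)
  ultimately have eq: "(v \<bullet> c) *\<^sub>R c - v = - (v \<bullet> a) *\<^sub>R a - (v \<bullet> b) *\<^sub>R b" by simp
  have "v = (v \<bullet> c) *\<^sub>R c - ((v \<bullet> c) *\<^sub>R c - v)" by simp
  also have "\<dots> = (v \<bullet> a) *\<^sub>R a + (v \<bullet> b) *\<^sub>R b + (v \<bullet> c) *\<^sub>R c"
    unfolding eq by simp
  finally show ?thesis unfolding c_def .
qed

text \<open>Differentiating the constant inner products fixes the components of \<open>T2\<close>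
  along \<open>\<gamma>\<close> and \<open>T\<close>; the component along the normal is the geodesic
  curvature by definition.\<close>

lemma sphere_frame:
  assumes "sphere_arclength_curve \<gamma> T T2"
  shows "norm (\<gamma> s) = 1" "norm (T s) = 1" "\<gamma> s \<bullet> T s = 0"
    "(\<gamma> has_vector_derivative T s) (at s)"
    "(T has_vector_derivative - \<gamma> s + geod_curv \<gamma> T T2 s *\<^sub>R cross3 (\<gamma> s) (T s)) (at s)"
    "((\<lambda>s. cross3 (\<gamma> s) (T s)) has_vector_derivative - geod_curv \<gamma> T T2 s *\<^sub>R T s) (at s)"
proof -
  note A = assms[unfolded sphere_arclength_curve_def]
  show n: "norm (\<gamma> s) = 1" "norm (T s) = 1" for s using A by auto
  show d: "(\<gamma> has_vector_derivative T s) (at s)" for s using A by auto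
  have d2: "(T has_vector_derivative T2 s) (at s)" for s using A by auto
  note inner_deriv = bounded_bilinear.has_vector_derivative[OF bounded_bilinear_inner]
  have gT: "\<gamma> s \<bullet> T s = 0" for s
  proof -
    have "((\<lambda>s. \<gamma> s \<bullet> \<gamma> s) has_vector_derivative \<gamma> s \<bullet> T s + T s \<bullet> \<gamma> s) (at s)"
      by (rule inner_deriv[OF d d])
    moreover have "((\<lambda>s. \<gamma> s \<bullet> \<gamma> s) has_vector_derivative 0) (at s)"
      using n by (simp add: dot_square_norm)
    ultimately have "\<gamma> s \<bullet> T s + T s \<bullet> \<gamma> s = 0" by (rule vector_derivative_unique_at)
    then show ?thesis by (simp add: inner_commute)
  qed
  then show "\<gamma> s \<bullet> T s = 0" .
  have "((\<lambda>s. \<gamma> s \<bullet> T s) has_vector_derivative \<gamma> s \<bullet> T2 s + T s \<bullet> T s) (at s)"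
    by (rule inner_deriv[OF d d2])
  moreover have "((\<lambda>s. \<gamma> s \<bullet> T s) has_vector_derivative 0) (at s)" using gT by simp
  ultimately have "\<gamma> s \<bullet> T2 s + T s \<bullet> T s = 0" by (rule vector_derivative_unique_at)
  then have 1: "T2 s \<bullet> \<gamma> s = - 1" using n by (simp add: dot_square_norm inner_commute)
  have "((\<lambda>s. T s \<bullet> T s) has_vector_derivative T s \<bullet> T2 s + T2 s \<bullet> T s) (at s)"
    by (rule inner_deriv[OF d2 d2])
  moreover have "((\<lambda>s. T s \<bullet> T s) has_vector_derivative 0) (at s)"
    using n by (simp add: dot_square_norm)
  ultimately have "T s \<bullet> T2 s + T2 s \<bullet> T s = 0" by (rule vector_derivative_unique_at)
  then have 2: "T2 s \<bullet> T s = 0" by (simp add: inner_commute)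
  have T2: "T2 s = - \<gamma> s + geod_curv \<gamma> T T2 s *\<^sub>R cross3 (\<gamma> s) (T s)"
    using orthonormal_frame_expansion[OF n gT, of "T2 s" s] 1 2 by (simp add: geod_curv_def)
  then show "(T has_vector_derivative - \<gamma> s + geod_curv \<gamma> T T2 s *\<^sub>R cross3 (\<gamma> s) (T s)) (at s)"
    using d2[of s] by simp
  have "((\<lambda>s. cross3 (\<gamma> s) (T s)) has_vector_derivative cross3 (\<gamma> s) (T2 s) + cross3 (T s) (T s)) (at s)"
    by (rule has_vector_derivative_cross3[OF d d2])
  then show "((\<lambda>s. cross3 (\<gamma> s) (T s)) has_vector_derivative - geod_curv \<gamma> T T2 s *\<^sub>R T s) (at s)"
    by (simp add: T2 Cross3.right_diff_distrib cross_mult_right orthonormal_frame_cross[OF n gT])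
qed

lemma has_vector_derivative_vector3:
  assumes "(f has_real_derivative f') (at s)" "(g has_real_derivative g') (at s)"
    "(h has_real_derivative h') (at s)"
  shows "((\<lambda>s. vector [f s, g s, h s] :: real^3) has_vector_derivative vector [f', g', h']) (at s)"
proof -
  have *: "(vector [x, y, z] :: real^3) = x *\<^sub>R axis 1 1 + y *\<^sub>R axis 2 1 + z *\<^sub>R axis 3 1" for x y z
    by (simp add: vec_eq_iff forall_3 axis_def)
  show ?thesis
    unfolding * using assms
    by (auto intro!: derivative_eq_intros)
qed

text \<open>
  For a unit vector \<open>e\<close>, the functions \<open>z\<close>, \<open>z1\<close>, \<open>\<delta>\<close> are the inner products of \<open>e\<close> with the
  frame \<open>\<gamma>\<close>, \<open>T\<close>, \<open>N\<close>, and \<open>\<theta>\<close> is the polar angle of \<open>\<gamma>\<close> about \<open>e\<close>.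
\<close>

locale killing_coords =
  fixes z z1 \<delta> \<kappa> \<theta> :: "real \<Rightarrow> real"
  assumes z: "\<And>s. (z has_real_derivative z1 s) (at s)"
    and z1: "\<And>s. (z1 has_real_derivative - z s + \<kappa> s * \<delta> s) (at s)"
    and \<delta>: "\<And>s. (\<delta> has_real_derivative - \<kappa> s * z1 s) (at s)"
    and unit: "\<And>s. (z s)\<^sup>2 + (z1 s)\<^sup>2 + (\<delta> s)\<^sup>2 = 1"
    and \<delta>_pos: "\<And>s. 0 < \<delta> s"
    and \<theta>: "\<And>s. (\<theta> has_real_derivative \<delta> s / (1 - (z s)\<^sup>2)) (at s)"
begin

text \<open>Distance of the curve from the axis.\<close>

definition r :: "real \<Rightarrow> real" where "r s = sqrt (1 - (z s)\<^sup>2)"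

lemma z_sq_less: "(z s)\<^sup>2 < 1"
  using unit[of s] \<delta>_pos[of s] zero_le_power2[of "z1 s"] zero_less_power[of "\<delta> s" 2] by linarith

lemma r_pos: "0 < r s" and r_sq: "(r s)\<^sup>2 = 1 - (z s)\<^sup>2"
  using z_sq_less[of s] by (auto simp: r_def)

lemma r_deriv: "(r has_real_derivative - (z s * z1 s) / r s) (at s)"
  unfolding r_def using z_sq_less[of s]
  by (auto intro!: derivative_eq_intros z simp: field_simps)

text \<open>The equations for \<open>z\<close>, \<open>z1\<close>, \<open>\<delta>\<close> are those
  of the frame components of a fixed vector, so the vector assembled from them is constant; it is
  the axis \<open>e\<close>. What remains is the projection orthogonal to \<open>e\<close>, a plane
  curve with polar coordinates \<open>r\<close> and \<open>\<theta>\<close>.\<close>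

lemma curve_in_killing_coords:
  assumes \<gamma>: "sphere_arclength_curve \<gamma> T T2" "\<And>s. geod_curv \<gamma> T T2 s = \<kappa> s"
  obtains e W Z where "\<And>s. \<gamma> s = z s *\<^sub>R e + r s *\<^sub>R (cos (\<theta> s) *\<^sub>R W + sin (\<theta> s) *\<^sub>R Z)"
    "norm W = 1" "norm Z = 1" "W \<bullet> Z = 0"
proof -
  note F = sphere_frame[OF \<gamma>(1), unfolded \<gamma>(2)]
  define N where "N s = cross3 (\<gamma> s) (T s)" for s
  note C = orthonormal_frame_cross[OF F(1,2,3), folded N_def]
  define ef where "ef s = z s *\<^sub>R \<gamma> s + z1 s *\<^sub>R T s + \<delta> s *\<^sub>R N s" for s
  have hv: "((\<lambda>s. f s *\<^sub>R X s) has_vector_derivative f s *\<^sub>R X' + f' *\<^sub>R X s) (at s)"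
    if "(f has_real_derivative f') (at s)" "(X has_vector_derivative X') (at s)"
    for f f' s and X :: "real \<Rightarrow> real^3" and X'
    by (rule has_vector_derivative_scaleR[OF that])
  have "(ef has_vector_derivative 0) (at s)" for s
  proof -
    have "(ef has_vector_derivative (z s *\<^sub>R T s + z1 s *\<^sub>R \<gamma> s)
        + (z1 s *\<^sub>R (- \<gamma> s + \<kappa> s *\<^sub>R N s) + (- z s + \<kappa> s * \<delta> s) *\<^sub>R T s)
        + (\<delta> s *\<^sub>R (- \<kappa> s *\<^sub>R T s) + (- \<kappa> s * z1 s) *\<^sub>R N s)) (at s)"
      unfolding ef_def N_def
      by (intro has_vector_derivative_add hv z z1 \<delta> F)
    then show ?thesis by (simp add: algebra_simps)
  qed
  then have "ef s = ef 0" for s by (rule has_vector_derivative_zero_imp_eq)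
  then obtain e where e: "\<And>s. e = z s *\<^sub>R \<gamma> s + z1 s *\<^sub>R T s + \<delta> s *\<^sub>R N s"
    unfolding ef_def by metis
  have dots: "\<gamma> s \<bullet> \<gamma> s = 1" "T s \<bullet> T s = 1" "N s \<bullet> N s = 1" "\<gamma> s \<bullet> T s = 0" "T s \<bullet> \<gamma> s = 0"
    "\<gamma> s \<bullet> N s = 0" "T s \<bullet> N s = 0" "N s \<bullet> \<gamma> s = 0" "N s \<bullet> T s = 0" for s
    using F(1,2,3)[of s] C(3)[of s] by (auto simp: dot_square_norm inner_commute N_def dot_cross_self)
  have e\<gamma>: "e \<bullet> \<gamma> s = z s" for s
    by (subst e[of s]) (simp add: inner_left_distrib dots)
  have ee: "e \<bullet> e = 1"
    by (subst e[of 0], subst e[of 0])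
       (use unit[of 0] in \<open>simp add: inner_left_distrib inner_right_distrib dots power2_eq_square\<close>)
  \<comment> \<open>\<open>B\<close> is the projection of the curve orthogonal to \<open>e\<close>,
    and \<open>D\<close> is \<open>B\<close> turned by a right angle about \<open>e\<close>.\<close>
  define B where "B s = \<gamma> s - z s *\<^sub>R e" for s
  define D where "D s = cross3 e (\<gamma> s)" for s
  define \<mu> where "\<mu> s = z s * z1 s / (r s)\<^sup>2" for s
  define \<omega> where "\<omega> s = \<delta> s / (r s)\<^sup>2" for s
  have D_eq: "D s = \<delta> s *\<^sub>R T s - z1 s *\<^sub>R N s" for s
    unfolding D_def
    by (subst e[of s]) (simp add: cross_add_left cross_mult_left C N_def[symmetric] cross_skew[of "T s" "\<gamma> s"])
  have eD: "cross3 e (D s) = - B s" and eB: "cross3 e (B s) = D s" for s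
    by (simp_all add: D_def B_def Lagrange e\<gamma> ee Cross3.right_diff_distrib cross_mult_right)
  \<comment> \<open>In complex notation this says \<open>B' = (- \<mu> + i \<omega>) B\<close>:
    contraction at the rate \<open>\<mu> = - r' / r\<close> and rotation with speed
    \<open>\<omega> = \<theta>'\<close>.\<close>
  have B': "T s - z1 s *\<^sub>R e = - \<mu> s *\<^sub>R B s + \<omega> s *\<^sub>R D s" for s
  proof -
    have r2: "(r s)\<^sup>2 \<noteq> 0" using r_pos[of s] by simp
    have "(r s)\<^sup>2 *\<^sub>R (T s - z1 s *\<^sub>R e) = - (z s * z1 s) *\<^sub>R B s + \<delta> s *\<^sub>R D s"
    proof -
      have "(r s)\<^sup>2 *\<^sub>R (T s - z1 s *\<^sub>R e) - (- (z s * z1 s) *\<^sub>R B s + \<delta> s *\<^sub>R D s)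
          = (z s * z1 s * (1 - (r s)\<^sup>2 - (z s)\<^sup>2)) *\<^sub>R \<gamma> s
            + ((r s)\<^sup>2 * (1 - (z1 s)\<^sup>2) - (z s)\<^sup>2 * (z1 s)\<^sup>2 - (\<delta> s)\<^sup>2) *\<^sub>R T s
            + (z1 s * \<delta> s * (1 - (r s)\<^sup>2 - (z s)\<^sup>2)) *\<^sub>R N s"
        unfolding D_eq B_def e[of s] by (simp add: algebra_simps power2_eq_square)
      moreover have "(r s)\<^sup>2 * (1 - (z1 s)\<^sup>2) - (z s)\<^sup>2 * (z1 s)\<^sup>2 - (\<delta> s)\<^sup>2 = 0"
        using unit[of s] unfolding r_sq by (simp add: algebra_simps)
      ultimately show ?thesis by (simp add: r_sq)
    qed
    then have "(1 / (r s)\<^sup>2) *\<^sub>R ((r s)\<^sup>2 *\<^sub>R (T s - z1 s *\<^sub>R e))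
        = (1 / (r s)\<^sup>2) *\<^sub>R (- (z s * z1 s) *\<^sub>R B s + \<delta> s *\<^sub>R D s)" by simp
    then show ?thesis using r2 by (simp add: \<mu>_def \<omega>_def scaleR_right_diff_distrib)
  qed
  have dB: "(B has_vector_derivative - \<mu> s *\<^sub>R B s + \<omega> s *\<^sub>R D s) (at s)" for s
  proof -
    have "(B has_vector_derivative T s - (z s *\<^sub>R 0 + z1 s *\<^sub>R e)) (at s)"
      unfolding B_def by (intro has_vector_derivative_diff hv z F has_vector_derivative_const)
    then show ?thesis using B'[of s] by simp
  qed
  have dD: "(D has_vector_derivative - \<mu> s *\<^sub>R D s - \<omega> s *\<^sub>R B s) (at s)" for s
  proof -
    have "(D has_vector_derivative cross3 e (T s) + cross3 0 (\<gamma> s)) (at s)"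
      unfolding D_def by (intro has_vector_derivative_cross3 F has_vector_derivative_const)
    moreover have "cross3 e (T s) = cross3 e (T s - z1 s *\<^sub>R e)"
      by (simp add: Cross3.right_diff_distrib cross_mult_right)
    ultimately show ?thesis
      unfolding B' by (simp add: Cross3.right_diff_distrib cross_mult_right eB eD minus_diff_commute)
  qed
  have ir: "((\<lambda>s. 1 / r s) has_real_derivative \<mu> s / r s) (at s)" for s
    using r_pos[of s] by (auto intro!: derivative_eq_intros r_deriv simp: \<mu>_def power2_eq_square)
  have \<theta>': "(\<theta> has_real_derivative \<omega> s) (at s)" for s using \<theta> by (simp add: \<omega>_def r_sq)
  have dc: "((\<lambda>s. cos (\<theta> s)) has_real_derivative - sin (\<theta> s) * \<omega> s) (at s)"
    and ds: "((\<lambda>s. sin (\<theta> s)) has_real_derivative cos (\<theta> s) * \<omega> s) (at s)" for s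
    by (auto intro!: derivative_eq_intros \<theta>')
  \<comment> \<open>Rescaling by \<open>1 / r\<close> and turning back by \<open>\<theta>\<close>
    undoes contraction and rotation, so \<open>Wf\<close> and \<open>Zf\<close> do not move.\<close>
  define Wf where "Wf s = (1 / r s) *\<^sub>R (cos (\<theta> s) *\<^sub>R B s - sin (\<theta> s) *\<^sub>R D s)" for s
  define Zf where "Zf s = (1 / r s) *\<^sub>R (sin (\<theta> s) *\<^sub>R B s + cos (\<theta> s) *\<^sub>R D s)" for s
  have "(Wf has_vector_derivative
      (1 / r s) *\<^sub>R ((cos (\<theta> s) *\<^sub>R (- \<mu> s *\<^sub>R B s + \<omega> s *\<^sub>R D s) + (- sin (\<theta> s) * \<omega> s) *\<^sub>R B s)
        - (sin (\<theta> s) *\<^sub>R (- \<mu> s *\<^sub>R D s - \<omega> s *\<^sub>R B s) + (cos (\<theta> s) * \<omega> s) *\<^sub>R D s))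
      + (\<mu> s / r s) *\<^sub>R (cos (\<theta> s) *\<^sub>R B s - sin (\<theta> s) *\<^sub>R D s)) (at s)" for s
    unfolding Wf_def by (intro hv has_vector_derivative_diff ir dc ds dB dD)
  then have "(Wf has_vector_derivative 0) (at s)" for s
    by (simp add: algebra_simps)
  then have W: "Wf s = Wf 0" for s by (rule has_vector_derivative_zero_imp_eq)
  have "(Zf has_vector_derivative
      (1 / r s) *\<^sub>R ((sin (\<theta> s) *\<^sub>R (- \<mu> s *\<^sub>R B s + \<omega> s *\<^sub>R D s) + (cos (\<theta> s) * \<omega> s) *\<^sub>R B s)
        + (cos (\<theta> s) *\<^sub>R (- \<mu> s *\<^sub>R D s - \<omega> s *\<^sub>R B s) + (- sin (\<theta> s) * \<omega> s) *\<^sub>R D s))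
      + (\<mu> s / r s) *\<^sub>R (sin (\<theta> s) *\<^sub>R B s + cos (\<theta> s) *\<^sub>R D s)) (at s)" for s
    unfolding Zf_def by (intro hv has_vector_derivative_add ir dc ds dB dD)
  then have "(Zf has_vector_derivative 0) (at s)" for s
    by (simp add: algebra_simps)
  then have Z: "Zf s = Zf 0" for s by (rule has_vector_derivative_zero_imp_eq)
  have BB: "B s \<bullet> B s = (r s)\<^sup>2" and BD: "B s \<bullet> D s = 0" and DD: "D s \<bullet> D s = (r s)\<^sup>2" for s
  proof -
    show "B s \<bullet> B s = (r s)\<^sup>2"
      unfolding r_sq
      by (simp add: B_def inner_diff_left inner_diff_right dots e\<gamma> ee inner_commute[of "\<gamma> s" e] power2_eq_square)
    show "B s \<bullet> D s = 0" by (simp add: B_def D_def inner_diff_left dot_cross_self)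
    show "D s \<bullet> D s = (r s)\<^sup>2"
      unfolding r_sq
      by (simp add: D_def dot_cross ee dots e\<gamma> inner_commute[of "\<gamma> s" e] power2_eq_square)
  qed
  have sc: "(cos x)\<^sup>2 + (sin x)\<^sup>2 = 1" for x :: real by simp
  have "Wf 0 \<bullet> Wf 0 = ((cos (\<theta> 0))\<^sup>2 + (sin (\<theta> 0))\<^sup>2) * ((r 0)\<^sup>2 / (r 0)\<^sup>2)"
    by (simp add: Wf_def inner_diff_left inner_diff_right BB BD DD inner_commute[of "D 0" "B 0"] power2_eq_square
        add_divide_distrib del: sin_cos_squared_add sin_cos_squared_add2 sin_cos_squared_add3)
  then have "Wf 0 \<bullet> Wf 0 = 1" using r_pos[of 0] unfolding sc by simp
  moreover have "Zf 0 \<bullet> Zf 0 = ((sin (\<theta> 0))\<^sup>2 + (cos (\<theta> 0))\<^sup>2) * ((r 0)\<^sup>2 / (r 0)\<^sup>2)"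
    by (simp add: Zf_def inner_add_left inner_add_right BB BD DD inner_commute[of "D 0" "B 0"] power2_eq_square
        add_divide_distrib del: sin_cos_squared_add sin_cos_squared_add2 sin_cos_squared_add3)
  then have "Zf 0 \<bullet> Zf 0 = 1" using r_pos[of 0] by simp
  moreover have "Wf 0 \<bullet> Zf 0 = 0"
    by (simp add: Wf_def Zf_def inner_diff_left inner_add_right BB BD DD inner_commute[of "D 0" "B 0"])
  moreover have "\<gamma> s = z s *\<^sub>R e + r s *\<^sub>R (cos (\<theta> s) *\<^sub>R Wf 0 + sin (\<theta> s) *\<^sub>R Zf 0)" for s
  proof -
    have "cos (\<theta> s) *\<^sub>R Wf s + sin (\<theta> s) *\<^sub>R Zf s
        = ((1 / r s) * ((cos (\<theta> s))\<^sup>2 + (sin (\<theta> s))\<^sup>2)) *\<^sub>R B s"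
      unfolding Wf_def Zf_def
      by (simp add: algebra_simps power2_eq_square add_divide_distrib
          del: sin_cos_squared_add sin_cos_squared_add2 sin_cos_squared_add3)
    then have "cos (\<theta> s) *\<^sub>R Wf s + sin (\<theta> s) *\<^sub>R Zf s = (1 / r s) *\<^sub>R B s" unfolding sc by simp
    then show ?thesis using r_pos[of s] by (simp add: W[of s] Z[of s] B_def)
  qed
  ultimately show ?thesis
    using that[of e "Wf 0" "Zf 0"] by (simp add: norm_eq_1)
qed

text \<open>The curve is written down in cylindrical coordinates \<open>r\<close>,
  \<open>\<theta>\<close>, \<open>z\<close> about the third axis. \<open>T2\<close> is set to the
  value that gives the prescribed curvature, and the work is to verify that it is the derivative of
  \<open>T\<close>.\<close>

lemma curve_exists:
  assumes "\<And>s. isCont \<kappa> s"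
  obtains \<gamma> T T2 where "sphere_arclength_curve \<gamma> T T2" "\<And>s. geod_curv \<gamma> T T2 s = \<kappa> s"
proof -
  define c where "c s = cos (\<theta> s)" for s
  define d where "d s = sin (\<theta> s)" for s
  \<comment> \<open>\<open>- m\<close> and \<open>n\<close> are the radial and azimuthal components
    \<open>r'\<close> and \<open>r * \<theta>'\<close> of the velocity.\<close>
  define m where "m s = z s * z1 s / r s" for s
  define n where "n s = \<delta> s / r s" for s
  define \<gamma> :: "real \<Rightarrow> real^3" where "\<gamma> s = vector [r s * c s, r s * d s, z s]" for s
  define T :: "real \<Rightarrow> real^3" where "T s = vector [- m s * c s - n s * d s, - m s * d s + n s * c s, z1 s]" for s
  define T2 where "T2 s = - \<gamma> s + \<kappa> s *\<^sub>R cross3 (\<gamma> s) (T s)" for s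
  have cd: "c s * c s + d s * d s = 1" for s
    using sin_cos_squared_add[of "\<theta> s"] by (simp add: c_def d_def power2_eq_square)
  have r0: "r s \<noteq> 0" for s using r_pos[of s] by simp
  define \<omega> where "\<omega> s = \<delta> s / (r s)\<^sup>2" for s
  have \<theta>': "(\<theta> has_real_derivative \<omega> s) (at s)" for s using \<theta> by (simp add: \<omega>_def r_sq)
  have dc: "(c has_real_derivative - d s * \<omega> s) (at s)" and dd: "(d has_real_derivative c s * \<omega> s) (at s)" for s
    unfolding c_def d_def by (auto intro!: derivative_eq_intros \<theta>')
  have rm: "r s * m s = z s * z1 s" and rn: "r s * n s = \<delta> s" and r\<omega>: "r s * \<omega> s = n s" for s
    using r0[of s] by (auto simp: m_def n_def \<omega>_def power2_eq_square)
  have rr: "r s * r s = 1 - z s * z s" for s using r_sq[of s] by (simp add: power2_eq_square)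
  have un: "z s * z s + z1 s * z1 s + \<delta> s * \<delta> s = 1" for s using unit[of s] by (simp add: power2_eq_square)
  have mn: "m s * m s + n s * n s + z1 s * z1 s = 1" for s
  proof -
    have "(r s * r s) * (m s * m s + n s * n s + z1 s * z1 s) = (r s * m s) * (r s * m s) + (r s * n s) * (r s * n s) + (r s * r s) * (z1 s * z1 s)"
      by (simp add: algebra_simps)
    also have "\<dots> = z1 s * z1 s + \<delta> s * \<delta> s" unfolding rm rn rr by (simp add: algebra_simps)
    also have "\<dots> = (r s * r s) * 1" using un[of s] rr[of s] by simp
    finally show ?thesis using r0[of s] by simp
  qed
  have ng: "norm (\<gamma> s) = 1" for s
  proof -
    have "\<gamma> s \<bullet> \<gamma> s = (r s * r s) * (c s * c s + d s * d s) + z s * z s"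
      by (simp add: \<gamma>_def inner_vec_def sum_3 algebra_simps)
    then show ?thesis unfolding cd rr by (simp add: norm_eq_1)
  qed
  have nT: "norm (T s) = 1" for s
  proof -
    have "T s \<bullet> T s = (m s * m s + n s * n s) * (c s * c s + d s * d s) + z1 s * z1 s"
      by (simp add: T_def inner_vec_def sum_3 algebra_simps)
    then show ?thesis unfolding cd using mn[of s] by (simp add: norm_eq_1)
  qed
  have gT: "\<gamma> s \<bullet> T s = 0" for s
  proof -
    have "\<gamma> s \<bullet> T s = - (r s * m s) * (c s * c s + d s * d s) + z s * z1 s"
      by (simp add: T_def \<gamma>_def inner_vec_def sum_3 algebra_simps)
    then show ?thesis unfolding cd rm by simp
  qed
  have rd: "(r has_real_derivative - m s) (at s)" for s using r_deriv[of s] by (simp add: m_def)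
  have g': "(\<gamma> has_vector_derivative T s) (at s)" for s
    unfolding \<gamma>_def[abs_def] T_def
  proof (rule has_vector_derivative_vector3)
    have "((\<lambda>s. r s * c s) has_real_derivative - m s * c s + (- d s * \<omega> s) * r s) (at s)"
      by (rule DERIV_mult[OF rd dc])
    then show "((\<lambda>s. r s * c s) has_real_derivative - m s * c s - n s * d s) (at s)"
      by (simp add: r\<omega>[symmetric] algebra_simps)
    have "((\<lambda>s. r s * d s) has_real_derivative - m s * d s + (c s * \<omega> s) * r s) (at s)"
      by (rule DERIV_mult[OF rd dd])
    then show "((\<lambda>s. r s * d s) has_real_derivative - m s * d s + n s * c s) (at s)"
      by (simp add: r\<omega>[symmetric] algebra_simps)
  qed (rule z)
  define m' where "m' s = (z1 s * z1 s + z s * (- z s + \<kappa> s * \<delta> s) + m s * m s) / r s" for s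
  define n' where "n' s = (- \<kappa> s * z1 s + n s * m s) / r s" for s
  have dm: "(m has_real_derivative m' s) (at s)" for s
    unfolding m_def[abs_def] using r0[of s]
    by (auto intro!: derivative_eq_intros z z1 rd simp: m'_def m_def) (simp add: field_simps)
  have dn: "(n has_real_derivative n' s) (at s)" for s
    unfolding n_def[abs_def] using r0[of s]
    by (auto intro!: derivative_eq_intros \<delta> rd simp: n'_def n_def) (simp add: field_simps)
  have N: "cross3 (\<gamma> s) (T s) = vector [r s * z1 s * d s + z s * m s * d s - z s * n s * c s,
      - z s * m s * c s - z s * n s * d s - r s * z1 s * c s, r s * n s]" for s
  proof -
    have "r s * c s * (- m s * d s + n s * c s) - r s * d s * (- m s * c s - n s * d s)
      = r s * n s * (c s * c s + d s * d s)" by (simp add: algebra_simps)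
    then have "r s * c s * (- m s * d s + n s * c s) - r s * d s * (- m s * c s - n s * d s) = r s * n s"
      unfolding cd by simp
    then show ?thesis
      by (simp add: vec_eq_iff forall_3 cross_components \<gamma>_def T_def algebra_simps)
  qed
  have rzm: "r s * (r s * z1 s + z s * m s) = z1 s" for s
  proof -
    have "r s * (r s * z1 s + z s * m s) = (r s * r s) * z1 s + z s * (r s * m s)" by (simp add: algebra_simps)
    then show ?thesis unfolding rm rr by (simp add: algebra_simps)
  qed
  \<comment> \<open>\<open>i1\<close> and \<open>i2\<close> match the radial and azimuthal
    components of \<open>T'\<close> with those of \<open>T2\<close>; multiplication by
    \<open>r\<close> clears the denominators.\<close>
  have i1: "m' s + n s * \<omega> s = r s + \<kappa> s * (z s * n s)" for s
  proof -
    have "r s * (m' s + n s * \<omega> s) = z1 s * z1 s + z s * (- z s + \<kappa> s * \<delta> s) + m s * m s + n s * n s"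
    proof -
      have "r s * m' s = z1 s * z1 s + z s * (- z s + \<kappa> s * \<delta> s) + m s * m s"
        using r0[of s] by (simp add: m'_def)
      moreover have "r s * (n s * \<omega> s) = n s * n s" using r\<omega>[of s] by (simp add: mult.left_commute)
      ultimately show ?thesis by (simp add: distrib_left)
    qed
    also have "\<dots> = 1 - z s * z s + \<kappa> s * z s * \<delta> s" using mn[of s] by (simp add: algebra_simps)
    also have "\<dots> = r s * (r s + \<kappa> s * (z s * n s))" unfolding rr[symmetric] rn[symmetric]
      by (simp add: algebra_simps)
    finally show ?thesis using r0[of s] by simp
  qed
  have i2: "m s * \<omega> s - n' s = \<kappa> s * (r s * z1 s + z s * m s)" for s
  proof -
    have "r s * (m s * \<omega> s - n' s) = \<kappa> s * z1 s"
    proof -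
      have "r s * n' s = - \<kappa> s * z1 s + n s * m s" using r0[of s] by (simp add: n'_def)
      moreover have "r s * (m s * \<omega> s) = n s * m s" using r\<omega>[of s] by (simp add: mult.left_commute)
      ultimately show ?thesis by (simp add: right_diff_distrib)
    qed
    also have "\<dots> = r s * (\<kappa> s * (r s * z1 s + z s * m s))" using rzm[of s] by simp
    finally show ?thesis using r0[of s] by simp
  qed
  have T': "(T has_vector_derivative T2 s) (at s)" for s
  proof -
    have "(T has_vector_derivative vector
       [- (m' s + n s * \<omega> s) * c s + (m s * \<omega> s - n' s) * d s,
        - (m' s + n s * \<omega> s) * d s - (m s * \<omega> s - n' s) * c s, - z s + \<kappa> s * \<delta> s]) (at s)"
      unfolding T_def[abs_def]
    proof (rule has_vector_derivative_vector3)
      show "((\<lambda>s. - m s * c s - n s * d s) has_real_derivative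
          - (m' s + n s * \<omega> s) * c s + (m s * \<omega> s - n' s) * d s) (at s)"
        by (auto intro!: derivative_eq_intros dm dn dc dd simp: algebra_simps)
      show "((\<lambda>s. - m s * d s + n s * c s) has_real_derivative
          - (m' s + n s * \<omega> s) * d s - (m s * \<omega> s - n' s) * c s) (at s)"
        by (auto intro!: derivative_eq_intros dm dn dc dd simp: algebra_simps)
    qed (rule z1)
    moreover have "vector
       [- (m' s + n s * \<omega> s) * c s + (m s * \<omega> s - n' s) * d s,
        - (m' s + n s * \<omega> s) * d s - (m s * \<omega> s - n' s) * c s, - z s + \<kappa> s * \<delta> s] = T2 s"
      unfolding i1 i2 T2_def N unfolding \<gamma>_def rn
      by (simp add: vec_eq_iff forall_3 algebra_simps)
    ultimately show ?thesis by simp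
  qed
  show ?thesis
  proof (rule that[of \<gamma> T T2])
    have "isCont \<gamma> s" "isCont T s" for s
      using g' T' has_vector_derivative_continuous by blast+
    then have "isCont T2 s" for s
      unfolding T2_def using assms by (intro continuous_intros continuous_cross) auto
    then show "sphere_arclength_curve \<gamma> T T2"
      unfolding sphere_arclength_curve_def
      using ng nT g' T' by (auto intro: continuous_at_imp_continuous_on)
    show "geod_curv \<gamma> T T2 s = \<kappa> s" for s
      using orthonormal_frame_cross(3)[OF ng nT gT]
      by (simp add: geod_curv_def T2_def inner_diff_left dot_cross_self dot_square_norm)
  qed
qed

end

section \<open>Elastic curves\<close>

locale elastica =
  fixes p :: real
  assumes p_pos: "0 < p" and p_less: "p < 1"
begin

abbreviation "q \<equiv> p / (1 - p)"

text \<open>Inverse of the substitution \<open>u = \<kappa> powr (p - 1)\<close>.\<close>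

definition curv :: "real \<Rightarrow> real" where "curv u = u powr (- 1 / (1 - p))"

end

sublocale elastica \<subseteq> power_well "p / (1 - p)"
  by unfold_locales (simp add: p_pos p_less)

context elastica
begin

text \<open>Parametrizes the constant of the first integral by the amplitude, as
  \<open>a = p^2 * energy R\<close>.\<close>

definition energy :: "real \<Rightarrow> real" where "energy R = pot q um + R\<^sup>2"

lemma q_eq: "q + 1 = 1 / (1 - p)" and pq: "p / q = 1 - p" and iq: "1 / q\<^sup>2 = (1 - p)\<^sup>2 / p\<^sup>2"
  using p_pos p_less by (auto simp: field_simps)

lemma curv_pos: "0 < u \<Longrightarrow> 0 < curv u" by (simp add: curv_def)

lemma curv_powr: "curv u powr c = u powr (- c / (1 - p))"
  by (simp add: curv_def powr_powr)

lemma curv_powr_simps: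
  assumes "0 < u"
  shows "curv u powr (p - 1) = u"
    and "curv u powr p = u powr (- q)"
    and "curv u powr (2 * p) = u powr (- 2 * q)"
    and "curv u powr (p + 1) = u powr (- 2 * q - 1)"
    and "curv u powr (2 * (p - 1)) = u\<^sup>2"
    and "curv u powr (2 * (1 - p)) = 1 / u\<^sup>2"
    and "curv u powr (2 - p) = u powr (- q) / u\<^sup>2"
proof -
  have e: "- (p - 1) / (1 - p) = 1" "- p / (1 - p) = - q" "- (2 * p) / (1 - p) = - 2 * q"
    "- (p + 1) / (1 - p) = - 2 * q - 1" "- (2 * (p - 1)) / (1 - p) = 2" "- (2 * (1 - p)) / (1 - p) = - 2"
    "- (2 - p) / (1 - p) = - q - 2"
    using p_less by (simp_all add: divide_simps)
  show "curv u powr (p - 1) = u" "curv u powr p = u powr (- q)"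
    "curv u powr (2 * p) = u powr (- 2 * q)" "curv u powr (p + 1) = u powr (- 2 * q - 1)"
    "curv u powr (2 * (p - 1)) = u\<^sup>2"
    unfolding curv_powr e using assms by simp_all
  show "curv u powr (2 * (1 - p)) = 1 / u\<^sup>2"
    unfolding curv_powr e using assms by (simp add: powr_minus_divide)
  show "curv u powr (2 - p) = u powr (- q) / u\<^sup>2"
    unfolding curv_powr e unfolding powr_diff using assms by simp
qed

lemma curv_eq: "curv u = u powr (- q - 1)"
proof -
  have "- 1 / (1 - p) = - q - 1" using p_less by (simp add: divide_simps)
  then show ?thesis by (simp only: curv_def)
qed

lemma curv_of_powr: "0 < k \<Longrightarrow> curv (k powr (p - 1)) = k"
proof -
  have e: "(p - 1) * (- 1 / (1 - p)) = 1" using p_less by (simp add: divide_simps)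
  show "0 < k \<Longrightarrow> curv (k powr (p - 1)) = k" unfolding curv_def powr_powr e by simp
qed

lemma curv_inj: "0 < u \<Longrightarrow> 0 < v \<Longrightarrow> curv u = curv v \<Longrightarrow> u = v"
  using curv_powr_simps(1) by metis

text \<open>The threshold for \<open>a\<close> is the rescaled energy of the rest point, so positive
  amplitude means \<open>a > a_star p\<close>.\<close>

lemma a_star_eq: "a_star p = p\<^sup>2 * pot q um"
proof -
  have e: "(- 1 / (2 * q + 2)) * 2 = p - 1"
  proof -
    have "2 * q + 2 = 2 / (1 - p)" using q_eq by simp
    then show ?thesis using p_less by simp
  qed
  have "um\<^sup>2 = um powr 2" using u0_pos by simp
  also have "\<dots> = q powr (p - 1)" unfolding argmin_pot_def powr_powr e ..
  also have "\<dots> = p powr (p - 1) * (1 - p) powr (1 - p)"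
  proof -
    have "q powr (p - 1) = p powr (p - 1) / (1 - p) powr (p - 1)"
      using p_pos p_less by (simp add: powr_divide)
    moreover have "(1 - p) powr (1 - p) = 1 / (1 - p) powr (p - 1)"
      using powr_minus_divide[of "1 - p" "p - 1"] by simp
    ultimately show ?thesis by simp
  qed
  finally have um2: "um\<^sup>2 = p powr (p - 1) * (1 - p) powr (1 - p)" .
  have "(q + 1) / q = 1 / p" using p_pos p_less by (simp add: q_eq)
  then have "pot q um = um\<^sup>2 * (1 / p)" by (metis pot_um times_divide_eq_right)
  then have "p\<^sup>2 * pot q um = p * um\<^sup>2" using p_pos by (simp add: power2_eq_square)
  also have "\<dots> = a_star p"
    using p_pos powr_mult_base[of p "p - 1"] by (simp add: um2 a_star_def mult.assoc[symmetric])
  finally show ?thesis by simp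
qed

lemma energy_pos: "0 < energy R"
  using pot_gt_sq[OF u0_pos] zero_le_power2[of um] zero_le_power2[of R] unfolding energy_def by linarith

lemma sqrt_energy: "sqrt (p\<^sup>2 * energy R) = p * sqrt (energy R)"
  using p_pos by (simp add: real_sqrt_mult)

text \<open>Links the integrand of the angular progression, written in the curvature, to the angular
  speed written in \<open>u\<close>.\<close>

lemma angular_speed_eq_rate:
  assumes "0 < u" "u\<^sup>2 < energy R"
  shows "(1 - p) * sqrt (p\<^sup>2 * energy R) * (curv u powr (2 - p) /
      (p\<^sup>2 * energy R * curv u powr (2 * (1 - p)) - p\<^sup>2)) = rate q (energy R) u"
proof -
  define E where "E = energy R"
  define y where "y = u powr (- q)"
  have E: "0 < E - u\<^sup>2" using assms by (simp add: E_def)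
  have "p\<^sup>2 * E * (1 / u\<^sup>2) - p\<^sup>2 = p\<^sup>2 * (E - u\<^sup>2) / u\<^sup>2" using assms by (simp add: field_simps)
  then have "(1 - p) * (p * sqrt E) * (y / u\<^sup>2 / (p\<^sup>2 * E * (1 / u\<^sup>2) - p\<^sup>2))
      = (1 - p) / p * (sqrt E * y / (E - u\<^sup>2))"
    using assms p_pos E by (simp add: power2_eq_square)
  also have "\<dots> = sqrt E * y / (q * (E - u\<^sup>2))" using p_pos p_less by simp
  finally show ?thesis
    unfolding rate_def sqrt_energy curv_powr_simps[OF assms(1)] E_def y_def .
qed

section \<open>The zeros of Q and the integral Lambda\<close>

lemma Qpa_curv:
  assumes "0 < u"
  shows "Qpa p (p\<^sup>2 * E) (curv u) = p\<^sup>2 / u\<^sup>2 * (E - pot q u)"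
proof -
  have "(curv u)\<^sup>2 = curv u powr (2 * p) * curv u powr (2 * (1 - p))"
    using curv_pos[OF assms] by (simp add: powr_add[symmetric])
  also have "\<dots> = u powr (- 2 * q) / u\<^sup>2" unfolding curv_powr_simps[OF assms] by simp
  finally have "Qpa p (p\<^sup>2 * E) (curv u) = p\<^sup>2 * E / u\<^sup>2 - (1 - p)\<^sup>2 * (u powr (- 2 * q) / u\<^sup>2) - p\<^sup>2"
    unfolding Qpa_def curv_powr_simps(6)[OF assms] by simp
  also have "\<dots> = p\<^sup>2 / u\<^sup>2 * (E - u\<^sup>2 - u powr (- 2 * q) * ((1 - p)\<^sup>2 / p\<^sup>2))"
    using assms p_pos by (simp add: field_simps)
  finally show ?thesis unfolding iq[symmetric] by (simp add: pot_def algebra_simps)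
qed

text \<open>In the variable \<open>u\<close>, \<open>Qpa\<close> is a positive multiple of energy
  minus potential, so its zeros are the images of the turning points. The set is finite, which makes
  \<open>Min\<close> and \<open>Max\<close> in \<open>beta_zero\<close> and
  \<open>alpha_zero\<close> meaningful.\<close>

lemma Qpa_zeros:
  assumes "0 \<le> R"
  shows "{k. 0 < k \<and> Qpa p (p\<^sup>2 * energy R) k = 0} = {curv (h R), curv (h (- R))}"
proof -
  have Q: "Qpa p (p\<^sup>2 * energy R) (curv u) = 0 \<longleftrightarrow> u \<in> {h R, h (- R)}" if "0 < u" for u
    unfolding Qpa_curv[OF that] level_set[OF assms, symmetric] energy_def
    using that p_pos by auto
  show ?thesis
  proof (intro equalityI subsetI)
    fix k assume k: "k \<in> {k. 0 < k \<and> Qpa p (p\<^sup>2 * energy R) k = 0}"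
    then have "Qpa p (p\<^sup>2 * energy R) (curv (k powr (p - 1))) = 0" by (simp add: curv_of_powr)
    then have "k powr (p - 1) \<in> {h R, h (- R)}" using Q[of "k powr (p - 1)"] k by auto
    then have "curv (k powr (p - 1)) \<in> curv ` {h R, h (- R)}" by (rule imageI)
    then show "k \<in> {curv (h R), curv (h (- R))}" using k by (simp add: curv_of_powr)
  next
    fix k assume "k \<in> {curv (h R), curv (h (- R))}"
    then show "k \<in> {k. 0 < k \<and> Qpa p (p\<^sup>2 * energy R) k = 0}"
      using Q[of "h R"] Q[of "h (- R)"] h_pos curv_pos by auto
  qed
qed

lemma curv_antimono: "0 < u \<Longrightarrow> u < v \<Longrightarrow> curv v < curv u"
  unfolding curv_def using p_less by (intro powr_less_mono2_neg) auto

lemma powr_antimono: "0 < k \<Longrightarrow> k < l \<Longrightarrow> l powr (p - 1) < k powr (p - 1)"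
  using p_less by (intro powr_less_mono2_neg) auto

text \<open>Substitution \<open>u = k powr (p - 1)\<close> in the half-period antiderivative. The
  map is decreasing, so \<open>\<beta>\<close> corresponds to the outer turning point
  \<open>h R\<close>, and a sign appears.\<close>

lemma Lambda_eq_total_angle:
  assumes "0 < R"
  shows "Lambda p (p\<^sup>2 * energy R) = total_angle R"
proof -
  define E where "E = energy R"
  define \<beta> where "\<beta> = curv (h R)"
  define \<alpha> where "\<alpha> = curv (h (- R))"
  have hh: "h (- R) < h R" using assms by (intro h_strict_mono) simp
  then have ab: "0 < \<beta>" "\<beta> < \<alpha>"
    using curv_antimono h_pos curv_pos by (auto simp: \<alpha>_def \<beta>_def)
  have zeros: "beta_zero p (p\<^sup>2 * E) = \<beta>" "alpha_zero p (p\<^sup>2 * E) = \<alpha>"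
    using ab Qpa_zeros[of R] assms
    by (simp_all add: beta_zero_def alpha_zero_def E_def \<alpha>_def[symmetric] \<beta>_def[symmetric])
  have ends: "\<beta> powr (p - 1) = h R" "\<alpha> powr (p - 1) = h (- R)"
    by (simp_all add: \<alpha>_def \<beta>_def curv_powr_simps h_pos)
  obtain P where P: "continuous_on {h (- R)..h R} P"
    "\<And>u. u \<in> {h (- R)<..<h R} \<Longrightarrow> (P has_real_derivative rate q E u / sqrt (R\<^sup>2 - (w u)\<^sup>2)) (at u)"
    "total_angle R = 2 * (P (h R) - P (h (- R)))"
    using advance_half[OF assms rate_cont_range[of E R]]
    unfolding total_angle_def E_def energy_def by blast
  define f where "f k = k powr (1 - p) /
            ((p\<^sup>2 * E * k powr (2 * (1 - p)) - p^2) * sqrt (Qpa p (p\<^sup>2 * E) k))" for k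
  define c where "c = p * (1 - p)\<^sup>2 * sqrt (p\<^sup>2 * E)"
  \<comment> \<open>The integrand is unbounded near both ends; the fundamental theorem with
    derivatives only in the interior gives integrability and value at once.\<close>
  have "((\<lambda>k. c * f k) has_integral - P (\<alpha> powr (p - 1)) - - P (\<beta> powr (p - 1))) {\<beta>..\<alpha>}"
  proof (rule fundamental_theorem_of_calculus_interior)
    have into: "k powr (p - 1) \<in> {h (- R)..h R}" if "k \<in> {\<beta>..\<alpha>}" for k
      using powr_antimono[of \<beta> k] powr_antimono[of k \<alpha>] that ab unfolding ends[symmetric]
      by (cases "k = \<beta>"; cases "k = \<alpha>") (auto simp: less_imp_le)
    show "continuous_on {\<beta>..\<alpha>} (\<lambda>k. - P (k powr (p - 1)))"
    proof (intro continuous_on_minus continuous_on_compose2[OF P(1)])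
      show "continuous_on {\<beta>..\<alpha>} (\<lambda>k. k powr (p - 1))"
        using ab by (intro continuous_intros) auto
      show "(\<lambda>k. k powr (p - 1)) ` {\<beta>..\<alpha>} \<subseteq> {h (- R)..h R}" using into by blast
    qed
    fix k assume k: "k \<in> {\<beta><..<\<alpha>}"
    define u where "u = k powr (p - 1)"
    have k0: "0 < k" using k ab by simp
    have u: "0 < u" "curv u = k" using k0 by (auto simp: u_def curv_of_powr)
    have uin: "u \<in> {h (- R)<..<h R}"
      using powr_antimono[of \<beta> k] powr_antimono[of k \<alpha>] k ab k0 unfolding ends[symmetric] u_def by auto
    have D: "R\<^sup>2 - (w u)\<^sup>2 = E - pot q u" using V_conv_w[OF u(1)] by (simp add: E_def energy_def)
    have Dpos: "0 < E - pot q u"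
    proof -
      have "- R < w u" "w u < R"
        using w_strict_mono[of "h (- R)" u] w_strict_mono[of u "h R"] uin h_pos[of "- R"] u by auto
      then have "(w u)\<^sup>2 < R\<^sup>2" using abs_le_square_iff[of R "w u"] by linarith
      then show ?thesis using D by simp
    qed
    have uE: "u\<^sup>2 < E" using Dpos pot_gt_sq[OF u(1)] by simp
    define S where "S = sqrt (E - pot q u)"
    have S: "0 < S" using Dpos by (simp add: S_def)
    have Q: "sqrt (Qpa p (p\<^sup>2 * E) k) = p / u * S"
      unfolding Qpa_curv[OF u(1), unfolded u(2)] S_def
      using p_pos u(1) by (simp add: real_sqrt_mult real_sqrt_divide)
    have "((\<lambda>k. - P (k powr (p - 1))) has_real_derivative
        - (rate q E (k powr (p - 1)) / sqrt (R\<^sup>2 - (w (k powr (p - 1)))\<^sup>2) * ((p - 1) * k powr (p - 1 - 1)))) (at k)"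
      using P(2)[OF uin[unfolded u_def]] k0
      by (intro DERIV_minus DERIV_chain2[of P] has_real_derivative_powr)
    moreover have "- (rate q E (k powr (p - 1)) / sqrt (R\<^sup>2 - (w (k powr (p - 1)))\<^sup>2) * ((p - 1) * k powr (p - 1 - 1)))
        = c * f k"
    proof -
      have kk: "k powr (p - 1 - 1) = u / k" using k0 powr_diff[of k "p - 1" 1] by (simp add: u_def)
      have r: "rate q E u = (1 - p) * sqrt (p\<^sup>2 * E) * (k powr (2 - p) / (p\<^sup>2 * E * k powr (2 * (1 - p)) - p\<^sup>2))"
        using angular_speed_eq_rate[of u R] u uE by (simp add: E_def)
      have k2: "k powr (2 - p) = k * k powr (1 - p)" using k0 powr_mult_base[of k "1 - p"] by simp
      define X where "X = p\<^sup>2 * E * k powr (2 * (1 - p)) - p\<^sup>2"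
      define Y where "Y = sqrt (p\<^sup>2 * E)"
      define z where "z = k powr (1 - p)"
      \<comment> \<open>In the case \<open>X = 0\<close> both sides vanish, division by zero being
        0.\<close>
      have "- (rate q E u / S * ((p - 1) * (u / k))) = c * f k"
        unfolding r f_def c_def Q k2 X_def[symmetric] Y_def[symmetric] z_def[symmetric]
        using k0 u(1) S p_pos by (cases "X = 0") (simp_all add: divide_simps power2_eq_square, simp add: algebra_simps)
      then show ?thesis unfolding u_def[symmetric] D kk S_def[symmetric] .
    qed
    ultimately show "((\<lambda>k. - P (k powr (p - 1))) has_vector_derivative c * f k) (at k)"
      by (simp add: has_real_derivative_iff_has_vector_derivative)
  qed (use ab in simp)
  then have "integral {\<beta>..\<alpha>} (\<lambda>k. c * f k) = P (h R) - P (h (- R))"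
    unfolding ends by (subst integral_unique) auto
  then have "c * integral {\<beta>..\<alpha>} f = P (h R) - P (h (- R))" by simp
  then have "total_angle R = 2 * p * (1 - p)\<^sup>2 * sqrt (p\<^sup>2 * E) * integral {\<beta>..\<alpha>} f"
    using P(3) by (simp add: c_def)
  then show ?thesis
    unfolding Lambda_def E_def[symmetric] zeros f_def[abs_def] by simp
qed

section \<open>From elastic curves to phases and back\<close>

lemma first_integral_term:
  assumes "0 < k s" "(k has_real_derivative D) (at s)"
    "((\<lambda>t. k t powr (p - 1)) has_real_derivative v) (at s)"
  shows "p\<^sup>2 * (p - 1)\<^sup>2 * k s powr (2 * (p - 2)) * D\<^sup>2 = p\<^sup>2 * v\<^sup>2"
proof -
  have "((\<lambda>t. k t powr (p - 1)) has_real_derivative (p - 1) * k s powr (p - 1 - 1) * D) (at s)"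
    by (rule DERIV_chain2[OF has_real_derivative_powr assms(2)]) (rule assms)
  then have "v = (p - 1) * k s powr (p - 2) * D"
    using DERIV_unique[OF assms(3)] by simp
  moreover have "(k s powr (p - 2))\<^sup>2 = k s powr (2 * (p - 2))"
    using assms(1) by (simp add: powr_power mult.commute)
  ultimately show ?thesis by (simp add: power_mult_distrib)
qed

text \<open>After multiplication by \<open>p\<close>, the relation \<open>p / q = 1 - p\<close>
  turns the repulsive part of the force into the power \<open>p + 1\<close> of the
  curvature.\<close>

lemma elastic_ode_iff:
  assumes "0 < u"
  shows "p * v + (p - 1) * curv u powr (p + 1) + p * u = 0 \<longleftrightarrow> v = - pot1 q u / 2"
proof -
  have "p * (- pot1 q u / 2) = - (p * u) + p / q * u powr (- 2 * q - 1)"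
  proof -
    have "p * (- (2 * u - 2 / c * x) / 2) = - (p * u) + p / c * x" for c x :: real
      by (cases "c = 0") (simp_all add: field_simps)
    then show ?thesis unfolding pot1_def .
  qed
  then have *: "p * (- pot1 q u / 2) = - (p * u) - (p - 1) * curv u powr (p + 1)"
    unfolding pq curv_powr_simps[OF assms] by (simp add: algebra_simps)
  have "v = - pot1 q u / 2 \<longleftrightarrow> p * v = p * (- pot1 q u / 2)"
    by (subst mult_left_cancel) (use p_pos in auto)
  then show ?thesis unfolding * by auto
qed

lemma first_integral_iff:
  assumes "0 < u"
  shows "p\<^sup>2 * v\<^sup>2 + (p - 1)\<^sup>2 * curv u powr (2 * p) + p\<^sup>2 * curv u powr (2 * (p - 1)) = p\<^sup>2 * E
    \<longleftrightarrow> v\<^sup>2 + pot q u = E"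
proof -
  have "p\<^sup>2 * v\<^sup>2 + (p - 1)\<^sup>2 * curv u powr (2 * p) + p\<^sup>2 * curv u powr (2 * (p - 1))
      = p\<^sup>2 * (v\<^sup>2 + (u\<^sup>2 + u powr (- 2 * q) * ((1 - p)\<^sup>2 / p\<^sup>2)))"
    unfolding curv_powr_simps[OF assms] power2_commute[of p 1] using p_pos by (simp add: algebra_simps)
  also have "\<dots> = p\<^sup>2 * (v\<^sup>2 + pot q u)" unfolding iq[symmetric] by (simp add: pot_def)
  finally show ?thesis using p_pos by simp
qed

text \<open>For the power \<open>p - 1\<close> of the curvature, the elastic equation is the
  equation of motion and the first integral is conservation of energy. Applied to an arbitrary
  curve, this lets the closing statement cover all of them.\<close>

lemma gamma_a_phase:
  assumes G: "is_gamma_a p (p\<^sup>2 * energy R) \<gamma> T T2" and R: "0 < R"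
  obtains \<phi> where "is_phase R \<phi>" "\<And>s. geod_curv \<gamma> T T2 s = curv (h (R * sin (\<phi> s)))"
proof -
  define k where "k = geod_curv \<gamma> T T2"
  note G' = G[unfolded is_gamma_a_def p_elastic_def, folded k_def]
  have k: "0 < k s" for s using G' by blast
  obtain u1 u2 where u1: "\<And>s. ((\<lambda>t. k t powr (p - 1)) has_real_derivative u1 s) (at s)"
    and u2: "\<And>s. (u1 has_real_derivative u2 s) (at s)"
    and ode: "\<And>s. p * u2 s + (p - 1) * k s powr (p + 1) + p * k s powr (p - 1) = 0"
    using G' by blast
  have cu: "curv (k s powr (p - 1)) = k s" and up: "0 < k s powr (p - 1)" for s
    using k[of s] curv_of_powr by auto
  have "u2 s = - pot1 q (k s powr (p - 1)) / 2" for s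
    using elastic_ode_iff[OF up, of "u2 s" s] ode[of s] unfolding cu by simp
  then have u2': "(u1 has_real_derivative - pot1 q (k s powr (p - 1)) / 2) (at s)" for s
    using u2[of s] by simp
  have en: "(u1 s)\<^sup>2 + pot q (k s powr (p - 1)) = pot q um + R\<^sup>2" for s
  proof -
    have kd: "(k has_real_derivative deriv k s) (at s)"
      using G' DERIV_deriv_iff_real_differentiable by blast
    have "p^2 * (p - 1)^2 * k s powr (2 * (p - 2)) * (deriv k s)^2
        + (p - 1)^2 * k s powr (2 * p) + p^2 * k s powr (2 * (p - 1)) = p\<^sup>2 * energy R"
      using G' by blast
    then show ?thesis
      using first_integral_iff[OF up, of "u1 s" s "energy R"]
      unfolding first_integral_term[OF k kd u1] cu by (simp add: energy_def)
  qed
  obtain \<phi> where \<phi>: "is_phase R \<phi>" "\<And>s. k s powr (p - 1) = h (R * sin (\<phi> s))"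
    by (rule energy_solution_has_phase[OF R up u1 u2' en], rule that)
  then have "k s = curv (h (R * sin (\<phi> s)))" for s using cu[of s] by simp
  then show ?thesis using that \<phi>(1) by (simp add: k_def)
qed

text \<open>Injectivity of \<open>curv\<close> and of \<open>h\<close> gives the sines; since the
  equality of curvatures holds for all \<open>s\<close>, differentiating it gives the
  cosines.\<close>

lemma phase_sin_cos_of_curv_periodic:
  assumes \<phi>: "is_phase R \<phi>" and R: "0 < R"
    and per: "\<And>s. curv (h (R * sin (\<phi> (s + t)))) = curv (h (R * sin (\<phi> s)))"
  shows "sin (\<phi> (s + t)) = sin (\<phi> s)" "cos (\<phi> (s + t)) = cos (\<phi> s)"
proof -
  have h: "h (R * sin (\<phi> (s + t))) = h (R * sin (\<phi> s))" for s
    using curv_inj[OF h_pos h_pos per] .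
  then have "w (h (R * sin (\<phi> (s + t)))) = w (h (R * sin (\<phi> s)))" by simp
  then show "sin (\<phi> (s + t)) = sin (\<phi> s)" using R by simp
  have "((\<lambda>s. h (R * sin (\<phi> (s + t)))) has_real_derivative R * cos (\<phi> (s + t))) (at s)"
    using phase_solves(1)[OF \<phi>, of "s + t"] by (simp add: DERIV_shift)
  then have "R * cos (\<phi> (s + t)) = R * cos (\<phi> s)"
    unfolding h using phase_solves(1)[OF \<phi>] DERIV_unique by blast
  then show "cos (\<phi> (s + t)) = cos (\<phi> s)" using R by simp
qed

lemma curv_min_period:
  assumes \<phi>: "is_phase R \<phi>" and R: "0 < R"
  shows "is_min_period (\<lambda>s. curv (h (R * sin (\<phi> s)))) (period R)"
  unfolding is_min_period_def
proof (intro conjI allI impI notI)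
  show "0 < period R" by (rule period_pos)
  show "curv (h (R * sin (\<phi> (s + period R)))) = curv (h (R * sin (\<phi> s)))" for s
    by (simp add: is_phase_shift[OF \<phi>])
  fix t assume t: "0 < t \<and> t < period R" "\<forall>s. curv (h (R * sin (\<phi> (s + t)))) = curv (h (R * sin (\<phi> s)))"
  then show False
    using period_minimal[OF \<phi>, of t] phase_sin_cos_of_curv_periodic[OF \<phi> R, of t 0] by simp
qed

text \<open>The three coordinates are the frame components of the conserved vector divided by its
  length \<open>sqrt (energy R)\<close>. The equation of motion gives the derivative of the second,
  the chain rule that of the third, and conservation of energy the unit length.\<close>

lemma phase_killing_coords:
  assumes \<phi>: "is_phase R \<phi>" and R: "0 < R"
    and \<theta>: "\<And>s. (\<theta> has_real_derivative rate q (energy R) (h (R * sin (\<phi> s)))) (at s)"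
  shows "killing_coords (\<lambda>s. h (R * sin (\<phi> s)) / sqrt (energy R)) (\<lambda>s. R * cos (\<phi> s) / sqrt (energy R))
    (\<lambda>s. h (R * sin (\<phi> s)) powr (- q) / (q * sqrt (energy R))) (\<lambda>s. curv (h (R * sin (\<phi> s)))) \<theta>"
proof
  define E where "E = energy R"
  define u where "u s = h (R * sin (\<phi> s))" for s
  have E: "0 < E" and sE: "sqrt E * sqrt E = E" using energy_pos by (auto simp: E_def less_imp_le)
  have u: "0 < u s" for s by (simp add: u_def h_pos)
  fix s
  show "((\<lambda>s. h (R * sin (\<phi> s)) / sqrt (energy R)) has_real_derivative R * cos (\<phi> s) / sqrt (energy R)) (at s)"
    by (rule DERIV_cdivide[OF phase_solves(1)[OF \<phi>]])
  have qd: "curv (u s) * u s powr (- q) = u s powr (- 2 * q - 1)"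
    unfolding curv_eq powr_add[symmetric] by (rule arg_cong[where f = "\<lambda>x. u s powr x"]) simp
  show "((\<lambda>s. R * cos (\<phi> s) / sqrt (energy R)) has_real_derivative
      - (h (R * sin (\<phi> s)) / sqrt (energy R)) + curv (h (R * sin (\<phi> s))) *
         (h (R * sin (\<phi> s)) powr (- q) / (q * sqrt (energy R)))) (at s)"
  proof (rule DERIV_cong[OF DERIV_cdivide[OF phase_solves(2)[OF \<phi>]]])
    have "- pot1 q (u s) / 2 = - u s + curv (u s) * u s powr (- q) / q"
      unfolding qd by (simp add: pot1_def)
    then show "- pot1 q (h (R * sin (\<phi> s))) / 2 / sqrt (energy R) = - (h (R * sin (\<phi> s)) / sqrt (energy R)) +
        curv (h (R * sin (\<phi> s))) * (h (R * sin (\<phi> s)) powr (- q) / (q * sqrt (energy R)))"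
      unfolding u_def[symmetric] by (simp only: add_divide_distrib) simp
  qed
  show "((\<lambda>s. h (R * sin (\<phi> s)) powr (- q) / (q * sqrt (energy R))) has_real_derivative
      - curv (h (R * sin (\<phi> s))) * (R * cos (\<phi> s) / sqrt (energy R))) (at s)"
  proof (rule DERIV_cong[OF DERIV_cdivide[OF DERIV_chain2[OF has_real_derivative_powr phase_solves(1)[OF \<phi>]]]])
    show "0 < h (R * sin (\<phi> s))" by (rule h_pos)
    show "- q * h (R * sin (\<phi> s)) powr (- q - 1) * (R * cos (\<phi> s)) / (q * sqrt (energy R)) =
      - curv (h (R * sin (\<phi> s))) * (R * cos (\<phi> s) / sqrt (energy R))"
      unfolding curv_eq using p_pos p_less by simp
  qed
  have en: "(R * cos (\<phi> s))\<^sup>2 + pot q (u s) = E"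
  proof -
    have "(R * cos (\<phi> s))\<^sup>2 + (R * sin (\<phi> s))\<^sup>2 = R\<^sup>2 * ((cos (\<phi> s))\<^sup>2 + (sin (\<phi> s))\<^sup>2)"
      by (simp only: power_mult_distrib distrib_left)
    then show ?thesis using V_h[of "R * sin (\<phi> s)"] by (simp add: E_def energy_def u_def)
  qed
  have dd: "(u s powr (- q) / (q * sqrt E))\<^sup>2 = u s powr (- 2 * q) / q\<^sup>2 / E"
  proof -
    have "(u s powr (- q))\<^sup>2 = u s powr (- 2 * q)" using u[of s] by (simp add: powr_power)
    then show ?thesis using E by (simp add: power_divide power_mult_distrib)
  qed
  have "(u s / sqrt E)\<^sup>2 + (R * cos (\<phi> s) / sqrt E)\<^sup>2 + u s powr (- 2 * q) / q\<^sup>2 / E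
      = ((R * cos (\<phi> s))\<^sup>2 + pot q (u s)) / E"
  proof -
    have "(x / sqrt E)\<^sup>2 = x\<^sup>2 / E" for x using E by (simp add: power_divide)
    then show ?thesis by (simp only: pot_def add_divide_distrib[symmetric] add_ac)
  qed
  then show "(h (R * sin (\<phi> s)) / sqrt (energy R))\<^sup>2 + (R * cos (\<phi> s) / sqrt (energy R))\<^sup>2 +
      (h (R * sin (\<phi> s)) powr (- q) / (q * sqrt (energy R)))\<^sup>2 = 1"
    unfolding u_def[symmetric] E_def[symmetric] dd en using E by simp
  show "0 < h (R * sin (\<phi> s)) powr (- q) / (q * sqrt (energy R))"
    using h_pos[of "R * sin (\<phi> s)"] p_pos p_less energy_pos by (intro divide_pos_pos mult_pos_pos) auto
  have "rate q E (u s) = u s powr (- q) / (q * sqrt E) / (1 - (u s / sqrt E)\<^sup>2)"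
  proof -
    have "1 - (u s / sqrt E)\<^sup>2 = (E - (u s)\<^sup>2) / E" using E by (simp add: power_divide diff_divide_distrib)
    moreover have "x * y / (c * d) = y / (c * x) / (d / (x * x))" if "0 < x" for x y c d :: real
      using that by (simp add: divide_simps)
    from this[of "sqrt E"] have "sqrt E * y / (c * d) = y / (c * sqrt E) / (d / E)" for y c d
      using E by (simp only: sE real_sqrt_gt_zero)
    ultimately show ?thesis unfolding rate_def by (simp only:)
  qed
  then show "(\<theta> has_real_derivative h (R * sin (\<phi> s)) powr (- q) / (q * sqrt (energy R)) /
      (1 - (h (R * sin (\<phi> s)) / sqrt (energy R))\<^sup>2)) (at s)"
    using \<theta>[of s] by (simp add: E_def u_def)
qed

lemma angle_exists:
  assumes \<phi>: "is_phase R \<phi>"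
  obtains \<theta> where "\<And>s. (\<theta> has_real_derivative rate q (energy R) (h (R * sin (\<phi> s)))) (at s)"
    "\<And>s. \<theta> (s + period R) = \<theta> s + total_angle R"
proof -
  have rc: "isCont (rate q (energy R)) u" if "u \<in> range (\<lambda>\<psi>. h (R * sin \<psi>))" for u
    using rate_cont_range[OF _ that] by (simp add: energy_def)
  have "isCont (\<lambda>s. h (R * sin (\<phi> s))) s" for s
    using phase_solves(1)[OF \<phi>] DERIV_isCont by blast
  then have "isCont (\<lambda>s. rate q (energy R) (h (R * sin (\<phi> s)))) s" for s
    by (rule isCont_o2) (rule rc, simp)
  then obtain \<theta> where \<theta>: "\<And>s. (\<theta> has_real_derivative rate q (energy R) (h (R * sin (\<phi> s)))) (at s)"
    using antiderivative_exists by blast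
  moreover have "\<theta> (s + period R) = \<theta> s + total_angle R" for s
    using advance_shift[OF \<phi> rc \<theta>] by (simp add: total_angle_def energy_def)
  ultimately show ?thesis using that by blast
qed

lemma gamma_a_exists:
  assumes R: "0 < R"
  shows "\<exists>\<gamma> T T2. is_gamma_a p (p\<^sup>2 * energy R) \<gamma> T T2"
proof -
  obtain \<phi> where \<phi>: "is_phase R \<phi>" using is_phase_exists by blast
  obtain \<theta> where \<theta>: "\<And>s. (\<theta> has_real_derivative rate q (energy R) (h (R * sin (\<phi> s)))) (at s)"
    using angle_exists[OF \<phi>] by blast
  define u where "u s = h (R * sin (\<phi> s))" for s
  have u: "0 < u s" for s by (simp add: u_def h_pos)
  have du: "(u has_real_derivative R * cos (\<phi> s)) (at s)" for s
    unfolding u_def using phase_solves(1)[OF \<phi>] .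
  have dk: "((\<lambda>s. curv (u s)) has_real_derivative
      (- 1 / (1 - p)) * u s powr (- 1 / (1 - p) - 1) * (R * cos (\<phi> s))) (at s)" for s
    unfolding curv_def by (rule DERIV_chain2[OF has_real_derivative_powr du]) (rule u)
  obtain \<gamma> T T2 where \<gamma>: "sphere_arclength_curve \<gamma> T T2" "\<And>s. geod_curv \<gamma> T T2 s = curv (u s)"
    using killing_coords.curve_exists[OF phase_killing_coords[OF \<phi> R \<theta>]] DERIV_isCont[OF dk]
    unfolding u_def by blast
  have k: "geod_curv \<gamma> T T2 = (\<lambda>s. curv (u s))" using \<gamma>(2) by auto
  have en: "(R * cos (\<phi> s))\<^sup>2 + pot q (u s) = energy R" for s
  proof -
    have "(R * cos (\<phi> s))\<^sup>2 + (R * sin (\<phi> s))\<^sup>2 = R\<^sup>2 * ((cos (\<phi> s))\<^sup>2 + (sin (\<phi> s))\<^sup>2)"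
      by (simp only: power_mult_distrib distrib_left)
    then show ?thesis using V_h[of "R * sin (\<phi> s)"] by (simp add: energy_def u_def)
  qed
  have du': "((\<lambda>t. curv (u t) powr (p - 1)) has_real_derivative R * cos (\<phi> s)) (at s)" for s
    using du[of s] by (simp add: curv_powr_simps u)
  have "is_gamma_a p (p\<^sup>2 * energy R) \<gamma> T T2"
    unfolding is_gamma_a_def p_elastic_def k
  proof (intro conjI allI)
    show "sphere_arclength_curve \<gamma> T T2" by fact
    show "0 < curv (u s)" for s by (rule curv_pos[OF u])
    show "\<exists>u1 u2. \<forall>s. ((\<lambda>t. curv (u t) powr (p - 1)) has_real_derivative u1 s) (at s) \<and>
        (u1 has_real_derivative u2 s) (at s) \<and>
        p * u2 s + (p - 1) * curv (u s) powr (p + 1) + p * curv (u s) powr (p - 1) = 0"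
    proof (intro exI allI conjI)
      fix s
      show "((\<lambda>t. curv (u t) powr (p - 1)) has_real_derivative R * cos (\<phi> s)) (at s)" by (rule du')
      show "((\<lambda>s. R * cos (\<phi> s)) has_real_derivative - pot1 q (u s) / 2) (at s)"
        unfolding u_def by (rule phase_solves(2)[OF \<phi>])
      show "p * (- pot1 q (u s) / 2) + (p - 1) * curv (u s) powr (p + 1) + p * curv (u s) powr (p - 1) = 0"
        unfolding curv_powr_simps(1)[OF u] elastic_ode_iff[OF u] ..
    qed
    show "\<exists>s1 s2. curv (u s1) \<noteq> curv (u s2)"
    proof (rule ccontr)
      assume "\<not> (\<exists>s1 s2. curv (u s1) \<noteq> curv (u s2))"
      \<comment> \<open>A constant curvature would have half of its minimal period as a
        period.\<close>
      then have "\<forall>s. curv (u (s + period R / 2)) = curv (u s)" by blast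
      then show False
        using curv_min_period[OF \<phi> R] period_pos[of R]
        unfolding is_min_period_def u_def by (metis field_sum_of_halves half_gt_zero less_add_same_cancel1)
    qed
    show "\<exists>r>0. \<forall>s. curv (u (s + r)) = curv (u s)"
      using period_pos by (intro exI[of _ "period R"]) (simp add: u_def is_phase_shift[OF \<phi>])
    show "(\<lambda>s. curv (u s)) differentiable at s" for s
      using dk[of s] real_differentiable_def by blast
    show "p\<^sup>2 * (p - 1)\<^sup>2 * curv (u s) powr (2 * (p - 2)) * (deriv (\<lambda>s. curv (u s)) s)\<^sup>2 +
        (p - 1)\<^sup>2 * curv (u s) powr (2 * p) + p\<^sup>2 * curv (u s) powr (2 * (p - 1)) = p\<^sup>2 * energy R" for s
      unfolding DERIV_imp_deriv[OF dk] first_integral_term[OF curv_pos[OF u] dk du']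
        first_integral_iff[OF u] by (rule en)
  qed
  then show ?thesis by blast
qed

section \<open>Closing of the curve\<close>

lemma shift_iterate:
  fixes f :: "real \<Rightarrow> real"
  assumes "\<And>s. f (s + t) = f s + c"
  shows "f (s + real k * t) = f s + real k * c"
proof (induction k)
  case (Suc k)
  have "f (s + real (Suc k) * t) = f ((s + real k * t) + t)" by (simp add: algebra_simps)
  also have "\<dots> = f s + real k * c + c" using assms Suc by simp
  finally show ?case by (simp add: algebra_simps)
qed simp

text \<open>After \<open>k\<close> periods the height and the distance from the axis recur, while
  the polar angle has grown by \<open>k\<close> times the total angle; so the point at parameter 0
  recurs exactly when \<open>k * n / m\<close> is an integer.\<close>

lemma gamma_a_closes:
  assumes R: "0 < R" and L: "total_angle R = 2 * pi * real n / real m"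
    and m: "0 < m" and cop: "coprime n m"
    and G: "is_gamma_a p (p\<^sup>2 * energy R) \<gamma> T T2"
  shows "is_min_period (geod_curv \<gamma> T T2) (period R)"
    and "\<gamma> (s + real m * period R) = \<gamma> s"
    and "0 < k \<Longrightarrow> k < m \<Longrightarrow> \<gamma> (0 + real k * period R) \<noteq> \<gamma> 0"
    and "(1 - p) * sqrt (p\<^sup>2 * energy R) * integral {0..real m * period R}
           (\<lambda>s. geod_curv \<gamma> T T2 s powr (2 - p) /
              (p\<^sup>2 * energy R * geod_curv \<gamma> T T2 s powr (2 * (1 - p)) - p\<^sup>2)) = 2 * pi * real n"
proof -
  obtain \<phi> where \<phi>: "is_phase R \<phi>" and k: "\<And>s. geod_curv \<gamma> T T2 s = curv (h (R * sin (\<phi> s)))"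
    using gamma_a_phase[OF G R] by blast
  show "is_min_period (geod_curv \<gamma> T T2) (period R)"
    using curv_min_period[OF \<phi> R] k by (simp add: is_min_period_def)
  obtain \<theta> where \<theta>': "\<And>s. (\<theta> has_real_derivative rate q (energy R) (h (R * sin (\<phi> s)))) (at s)"
    and \<theta>s: "\<And>s. \<theta> (s + period R) = \<theta> s + total_angle R"
    using angle_exists[OF \<phi>] by blast
  note \<theta>k = shift_iterate[of \<theta>, OF \<theta>s]
  have mL: "real m * total_angle R = 2 * pi * real n" using L m by simp
  interpret killing_coords "\<lambda>s. h (R * sin (\<phi> s)) / sqrt (energy R)" "\<lambda>s. R * cos (\<phi> s) / sqrt (energy R)"
    "\<lambda>s. h (R * sin (\<phi> s)) powr (- q) / (q * sqrt (energy R))" "\<lambda>s. curv (h (R * sin (\<phi> s)))" \<theta>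
    by (rule phase_killing_coords[OF \<phi> R \<theta>'])
  have "sphere_arclength_curve \<gamma> T T2" using G by (simp add: is_gamma_a_def p_elastic_def)
  then obtain e W Z where \<gamma>: "\<And>s. \<gamma> s = (h (R * sin (\<phi> s)) / sqrt (energy R)) *\<^sub>R e
      + r s *\<^sub>R (cos (\<theta> s) *\<^sub>R W + sin (\<theta> s) *\<^sub>R Z)"
    and WZ: "norm W = 1" "norm Z = 1" "W \<bullet> Z = 0"
    using curve_in_killing_coords k by blast
  have hk: "h (R * sin (\<phi> (s + real k * period R))) = h (R * sin (\<phi> s))" for s and k :: nat
    using shift_iterate[of "\<lambda>s. h (R * sin (\<phi> s))" "period R" 0] by (simp add: is_phase_shift[OF \<phi>])
  then have rk: "r (s + real k * period R) = r s" for s and k :: nat by (simp add: r_def)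
  have "sin (\<theta> (s + real m * period R)) = sin (\<theta> s) \<and> cos (\<theta> (s + real m * period R)) = cos (\<theta> s)"
    unfolding sin_cos_eq_iff by (rule exI[of _ "int n"]) (simp add: \<theta>k mL)
  then show "\<gamma> (s + real m * period R) = \<gamma> s" unfolding \<gamma> hk rk by simp
  show "\<gamma> (0 + real k * period R) \<noteq> \<gamma> 0" if "0 < k" "k < m"
  proof
    assume eq: "\<gamma> (0 + real k * period R) = \<gamma> 0"
    define x where "x = \<theta> (0 + real k * period R)"
    have "r 0 *\<^sub>R (cos x *\<^sub>R W + sin x *\<^sub>R Z) = r 0 *\<^sub>R (cos (\<theta> 0) *\<^sub>R W + sin (\<theta> 0) *\<^sub>R Z)"
      using eq unfolding \<gamma> hk rk x_def by simp
    then have vec: "cos x *\<^sub>R W + sin x *\<^sub>R Z = cos (\<theta> 0) *\<^sub>R W + sin (\<theta> 0) *\<^sub>R Z"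
      using r_pos[of 0] by simp
    \<comment> \<open>Pairing with the orthonormal vectors \<open>W\<close> and \<open>Z\<close>
      recovers cosine and sine separately.\<close>
    have "(cos x *\<^sub>R W + sin x *\<^sub>R Z) \<bullet> W = cos x" "(cos x *\<^sub>R W + sin x *\<^sub>R Z) \<bullet> Z = sin x" for x
      using WZ inner_commute[of Z W] by (auto simp: inner_add_left dot_square_norm)
    then have "sin x = sin (\<theta> 0) \<and> cos x = cos (\<theta> 0)" using vec by metis
    then obtain j :: int where "x = \<theta> 0 + 2 * pi * j" unfolding sin_cos_eq_iff by blast
    then have "real k * total_angle R = 2 * pi * j" using \<theta>k[of 0 k] by (simp add: x_def)
    \<comment> \<open>Multiplying by \<open>m\<close> turns the recurrence into the integer equation
      \<open>k * n = j * m\<close>; coprimality then forces \<open>m\<close> to divide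
      \<open>k\<close>.\<close>
    then have "real k * (real m * total_angle R) = 2 * pi * j * real m" by (simp add: algebra_simps)
    then have "2 * pi * (real k * real n) = 2 * pi * (real_of_int j * real m)" unfolding mL by (simp add: algebra_simps)
    then have "real k * real n = real_of_int j * real m" by simp
    then have "real_of_int (int k * int n) = real_of_int (j * int m)" by simp
    then have "int k * int n = j * int m" by (simp only: of_int_eq_iff)
    then have "int m dvd int (k * n)" by simp
    then have "m dvd k * n" by (simp only: int_dvd_int_iff)
    then have "m dvd k" using cop by (simp add: coprime_commute coprime_dvd_mult_left_iff)
    then show False using that by (auto dest: dvd_imp_le)
  qed
  have "(1 - p) * sqrt (p\<^sup>2 * energy R) * (geod_curv \<gamma> T T2 s powr (2 - p) /
      (p\<^sup>2 * energy R * geod_curv \<gamma> T T2 s powr (2 * (1 - p)) - p\<^sup>2))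
    = rate q (energy R) (h (R * sin (\<phi> s)))" for s
    unfolding k by (rule angular_speed_eq_rate[OF h_pos]) (simp add: energy_def sq_lt_energy)
  then have "(1 - p) * sqrt (p\<^sup>2 * energy R) * integral {0..real m * period R}
           (\<lambda>s. geod_curv \<gamma> T T2 s powr (2 - p) /
              (p\<^sup>2 * energy R * geod_curv \<gamma> T T2 s powr (2 * (1 - p)) - p\<^sup>2))
      = integral {0..real m * period R} (\<lambda>s. rate q (energy R) (h (R * sin (\<phi> s))))"
    by (subst integral_mult_right[symmetric]) (simp only:)
  also have "\<dots> = \<theta> (0 + real m * period R) - \<theta> 0"
    using integral_eq_antiderivative_diff[OF \<theta>', of 0 "real m * period R"] period_pos[of R] by simp
  also have "\<dots> = 2 * pi * real n" unfolding \<theta>k mL by simp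
  finally show "(1 - p) * sqrt (p\<^sup>2 * energy R) * integral {0..real m * period R}
           (\<lambda>s. geod_curv \<gamma> T T2 s powr (2 - p) /
              (p\<^sup>2 * energy R * geod_curv \<gamma> T T2 s powr (2 * (1 - p)) - p\<^sup>2)) = 2 * pi * real n" .
qed

end

theorem mainTheorem8:
  fixes n m :: nat
  assumes "coprime n m"
    and "real m < 2 * real n" and "2 * real n < sqrt 2 * real m"
  shows "\<forall>p::real. 0 < p \<and> p < 1 \<longrightarrow>
    (\<exists>a. a > a_star p \<and> Lambda p a = 2 * pi * real n / real m \<and>
      (\<exists>\<gamma> T T2. is_gamma_a p a \<gamma> T T2) \<and>
      (\<forall>\<gamma> T T2. is_gamma_a p a \<gamma> T T2 \<longrightarrow>
         (\<exists>\<rho>. is_min_period (geod_curv \<gamma> T T2) \<rho> \<and>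
            (\<exists>s1 s2. geod_curv \<gamma> T T2 s1 \<noteq> geod_curv \<gamma> T T2 s2) \<and>
            (\<forall>s. \<gamma> (s + real m * \<rho>) = \<gamma> s) \<and>
            (\<forall>k::nat. 0 < k \<and> k < m \<longrightarrow> (\<exists>s. \<gamma> (s + real k * \<rho>) \<noteq> \<gamma> s)) \<and>
            (1 - p) * sqrt a *
              integral {0..real m * \<rho>}
                (\<lambda>s. geod_curv \<gamma> T T2 s powr (2 - p) /
                     (a * geod_curv \<gamma> T T2 s powr (2 * (1 - p)) - p^2))
              = 2 * pi * real n)))"
proof (intro allI impI)
  fix p :: real assume p: "0 < p \<and> p < 1"
  then interpret elastica p by unfold_locales auto
  \<comment> \<open>For \<open>m = 0\<close> the two inequalities would read
    \<open>0 < 2 * n < 0\<close>.\<close>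
  have m: "0 < m" using assms(2,3) by (cases "m = 0") auto
  define y where "y = 2 * pi * real n / real m"
  \<comment> \<open>Multiplied by pi / m, the inequalities between \<open>n\<close> and
    \<open>m\<close> say that the target angle lies strictly between the high-energy bound pi and
    the rest value \<open>sqrt 2 * pi\<close>.\<close>
  have "pi < y" "y < sqrt 2 * pi"
    using assms(2,3) m by (auto simp: y_def field_simps)
  then obtain R where R: "0 < R" "total_angle R = y" by (rule total_angle_attains)
  note closes = gamma_a_closes[OF R(1) R(2)[unfolded y_def] m assms(1)]
  show "\<exists>a. a > a_star p \<and> Lambda p a = 2 * pi * real n / real m \<and>
      (\<exists>\<gamma> T T2. is_gamma_a p a \<gamma> T T2) \<and>
      (\<forall>\<gamma> T T2. is_gamma_a p a \<gamma> T T2 \<longrightarrow>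
         (\<exists>\<rho>. is_min_period (geod_curv \<gamma> T T2) \<rho> \<and>
            (\<exists>s1 s2. geod_curv \<gamma> T T2 s1 \<noteq> geod_curv \<gamma> T T2 s2) \<and>
            (\<forall>s. \<gamma> (s + real m * \<rho>) = \<gamma> s) \<and>
            (\<forall>k::nat. 0 < k \<and> k < m \<longrightarrow> (\<exists>s. \<gamma> (s + real k * \<rho>) \<noteq> \<gamma> s)) \<and>
            (1 - p) * sqrt a *
              integral {0..real m * \<rho>}
                (\<lambda>s. geod_curv \<gamma> T T2 s powr (2 - p) /
                     (a * geod_curv \<gamma> T T2 s powr (2 * (1 - p)) - p^2))
              = 2 * pi * real n))"
  proof (rule exI[of _ "p\<^sup>2 * energy R"], intro conjI allI impI)
    show "a_star p < p\<^sup>2 * energy R" using R(1) p by (simp add: a_star_eq energy_def)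
    show "Lambda p (p\<^sup>2 * energy R) = 2 * pi * real n / real m"
      using Lambda_eq_total_angle[OF R(1)] R(2) by (simp add: y_def)
    show "\<exists>\<gamma> T T2. is_gamma_a p (p\<^sup>2 * energy R) \<gamma> T T2" by (rule gamma_a_exists[OF R(1)])
    fix \<gamma> T T2 assume G: "is_gamma_a p (p\<^sup>2 * energy R) \<gamma> T T2"
    have non_const: "\<exists>s1 s2. geod_curv \<gamma> T T2 s1 \<noteq> geod_curv \<gamma> T T2 s2"
      using G by (simp add: is_gamma_a_def)
    show "\<exists>\<rho>. is_min_period (geod_curv \<gamma> T T2) \<rho> \<and>
            (\<exists>s1 s2. geod_curv \<gamma> T T2 s1 \<noteq> geod_curv \<gamma> T T2 s2) \<and>
            (\<forall>s. \<gamma> (s + real m * \<rho>) = \<gamma> s) \<and>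
            (\<forall>k::nat. 0 < k \<and> k < m \<longrightarrow> (\<exists>s. \<gamma> (s + real k * \<rho>) \<noteq> \<gamma> s)) \<and>
            (1 - p) * sqrt (p\<^sup>2 * energy R) *
              integral {0..real m * \<rho>}
                (\<lambda>s. geod_curv \<gamma> T T2 s powr (2 - p) /
                     (p\<^sup>2 * energy R * geod_curv \<gamma> T T2 s powr (2 * (1 - p)) - p^2))
              = 2 * pi * real n"
    proof (rule exI[of _ "period R"], intro conjI allI impI)
      show "is_min_period (geod_curv \<gamma> T T2) (period R)" by (rule closes(1)[OF G])
    next
      fix s show "\<gamma> (s + real m * period R) = \<gamma> s" by (rule closes(2)[OF G])
    next
      fix k :: nat assume "0 < k \<and> k < m"
      then show "\<exists>s. \<gamma> (s + real k * period R) \<noteq> \<gamma> s"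
        using closes(3)[OF G, of k] by (intro exI[of _ 0]) blast
    next
      show "\<exists>s1 s2. geod_curv \<gamma> T T2 s1 \<noteq> geod_curv \<gamma> T T2 s2" by (rule non_const)
      show "(1 - p) * sqrt (p\<^sup>2 * energy R) *
              integral {0..real m * period R}
                (\<lambda>s. geod_curv \<gamma> T T2 s powr (2 - p) /
                     (p\<^sup>2 * energy R * geod_curv \<gamma> T T2 s powr (2 * (1 - p)) - p^2))
              = 2 * pi * real n" by (rule closes(4)[OF G])
    qed
  qed
qed

end
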